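(* Consider the problem of minimizing $\phi:=g-h$ over $\mathbb{R}^n$, where $g,h:\mathbb{R}^n\to\overline{\mathbb{R}}$ are strongly convex with modulus $\rho>0$, $g$ is strictly differentiable at the points in question, and $\phi$ is continuous on its domain. Let $\{x^k\}$ be a sequence generated by BDCA (described in the context) with parameters $\alpha>0$, $\bar\lambda>0$, $\beta\in(0,1)$ and stepsizes $\lambda_k$, let $\bar x$ be an accumulation point of $\{x^k\}$, and let $\nabla g$ be Lipschitz continuous with modulus $L$ around $\bar x$. Assume that $\phi$ satisfies the symmetric PLK condition at $\bar x$. Then for all large $k\in\mathbb{N}$ we have $$\phi(x^{k+1})\le\phi(x^k)-\frac{\alpha\lambda_k^2+\rho}{(1+\lambda_k)^2}\|x^{k+1}-x^k\|^2,$$ $$\text{there exists } w^k\in\partial^0\phi(x^k)\text{ such that }\|w^k\|\le L\|x^{k+1}-x^k\|,$$ and $\{x^k\}$ converges to $\bar x$ as $k\to\infty$, where $\bar x$ is a symmetric stationary point satisfying $0\in\partial^0\phi(\bar x)=\nabla g(\bar x)-\partial h(\bar x)$. If furthermore the symmetric PLK condition of $\phi$ at $\bar x$ holds in the exponent form with $\varphi(t)=Mt^{1-q}$ for some $M>0$ and $q\in[0,1)$, then: (i) if $q\in[0,\frac12)$, then $\{x^k\}$ terminates at $\bar x$ in a finite number of steps; (ii) if $q=\frac12$, then $\{x^k\}$ converges linearly to $\bar x$; (iii) if $q\in(\frac12,1)$, then there exists $\sigma>0$ such that $\|x^k-\bar x\|\le\sigma k^{-\frac{1-q}{2q-1}}$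 for all large $k\in\mathbb{N}$.
   Context: $\overline{\mathbb{R}}:=\mathbb{R}\cup\{\infty\}$; $\phi$ takes values in $\overline{\mathbb{R}}$. A function $f$ is strongly convex with modulus $\rho$ if $f-\frac{\rho}{2}\|\cdot\|^2$ is convex. For convex $h$, $\partial h$ is the subdifferential of convex analysis. BDCA: fix $\alpha>0$, $\bar\lambda>0$, $\beta\in(0,1)$, an initial point $x^0$, and $k:=0$. (Step 2) Select $u_k\in\partial h(x^k)$ and let $y^k$ be the unique solution of $\min_{x\in\mathbb{R}^n} g(x)-\langle u_k,x\rangle$. (Step 3) Let $d^k:=y^k-x^k$; if $d^k=0$, stop and return $x^k$. (Step 4) Choose any $\bar\lambda_k\ge 0$, set $\lambda_k:=\bar\lambda_k$, and while $\phi(y^k+\lambda_kd^k)>\phi(y^k)-\alpha\lambda_k^2\|d^k\|^2$ do $\lambda_k:=\beta\lambda_k$. (Step 5) Let $x^{k+1}:=y^k+\lambda_kd^k$; if $x^{k+1}=x^k$, stop and return $x^k$; otherwise set $k:=k+1$ and go to Step 2. If the algorithm stops at $x^k$, the sequence is understood as continued by $x^j:=x^k$, $\lambda_j:=0$ for $j\ge k$. The regular subdifferential $\widehat\partial\phi(x)$ is the set of $v$ with $\liminf_{u\to x,\,u\ne x}\frac{\phi(u)-\phi(x)-\langle v,u-x\rangle}{\|u-x\|}\ge 0$. The limiting subdifferential is $\partial\phi(x):=\{v\mid\exists\,x_k\to x,\ \phi(x_k)\to\phi(x),\ v_k\in\widehat\partial\phi(x_k),\ v_k\to v\}$. The symmetric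 subdifferential is $\partial^0\phi(x):=\partial\phi(x)\cup\big(-\partial(-\phi)(x)\big)$. Symmetric PLK condition at $\bar x$: $\phi$ is continuous around $\bar x$ and there exist $\eta\in(0,\infty)$, a neighborhood $U$ of $\bar x$, and a concave continuous function $\varphi:[0,\eta]\to[0,\infty)$ with $\varphi(0)=0$, $\varphi\in C^1(0,\eta)$, $\varphi'>0$ on $(0,\eta)$, such that $\varphi'(\phi(x)-\phi(\bar x))\,\mathrm{dist}(0,\partial^0\phi(x))\ge 1$ for all $x\in U$ with $\phi(\bar x)<\phi(x)<\phi(\bar x)+\eta$. The exponent form means that one can take $\varphi(t)=Mt^{1-q}$. Terminates at $\bar x$ in a finite number of steps: $x^k=\bar x$ for all large $k$. Converges linearly: $\|x^k-\bar x\|\le Cc^k$ for all large $k$ with some $C>0$, $c\in(0,1)$. *)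

theory Defs
  imports "HOL-Analysis.Analysis"
begin

text \<open>Extended-real-valued functions have type \<open>'a \<Rightarrow> ereal\<close>; the assumption that they never
  take the value \<open>-\<infinity>\<close> is stated where it is needed. In \<open>ereal\<close>, \<open>\<infinity> - \<infinity> = \<infinity>\<close>, so
  a difference \<open>g - h\<close> is \<open>\<infinity>\<close> exactly where \<open>g\<close> is, as long as \<open>h\<close> avoids \<open>-\<infinity>\<close>.\<close>

definition convex_fun :: "('a::real_vector \<Rightarrow> ereal) \<Rightarrow> bool" where
  "convex_fun f \<longleftrightarrow>
    (\<forall>x y t. 0 \<le> t \<and> t \<le> 1 \<longrightarrow>
      f ((1 - t) *\<^sub>R x + t *\<^sub>R y) \<le> ereal (1 - t) * f x + ereal t * f y)"

definition strongly_convex :: "real \<Rightarrow> ('a::real_normed_vector \<Rightarrow> ereal) \<Rightarrow> bool" where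
  "strongly_convex \<rho> f \<longleftrightarrow> convex_fun (\<lambda>x. f x - ereal (\<rho> / 2 * (norm x)\<^sup>2))"

definition convex_subdiff :: "('a::real_inner \<Rightarrow> ereal) \<Rightarrow> 'a \<Rightarrow> 'a set" where
  "convex_subdiff h x =
    {u. \<bar>h x\<bar> \<noteq> \<infinity> \<and> (\<forall>z. h x + ereal (u \<bullet> (z - x)) \<le> h z)}"

definition finite_near :: "('a::topological_space \<Rightarrow> ereal) \<Rightarrow> 'a \<Rightarrow> bool" where
  "finite_near f x \<longleftrightarrow> (\<forall>\<^sub>F u in nhds x. \<bar>f u\<bar> \<noteq> \<infinity>)"

text \<open>The quotient is \<open>0 / 0 = 0\<close> for \<open>u = w\<close>, so these pairs do not affect the limit.\<close>

definition strictly_differentiable :: "('a::real_inner \<Rightarrow> ereal) \<Rightarrow> 'a \<Rightarrow> bool" where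
  "strictly_differentiable f x \<longleftrightarrow> finite_near f x \<and>
    (\<exists>v. ((\<lambda>(u, w). (real_of_ereal (f u) - real_of_ereal (f w) - v \<bullet> (u - w)) / norm (u - w))
          \<longlongrightarrow> 0) (nhds (x, x)))"

definition has_gradient :: "('a::real_inner \<Rightarrow> ereal) \<Rightarrow> 'a \<Rightarrow> 'a \<Rightarrow> bool" where
  "has_gradient f x v \<longleftrightarrow> finite_near f x \<and> (GDERIV (\<lambda>u. real_of_ereal (f u)) x :> v)"

definition gradient :: "('a::real_inner \<Rightarrow> ereal) \<Rightarrow> 'a \<Rightarrow> 'a" where
  "gradient f x = (THE v. has_gradient f x v)"

definition gradient_lipschitz_around :: "('a::real_inner \<Rightarrow> ereal) \<Rightarrow> real \<Rightarrow> 'a \<Rightarrow> bool" where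
  "gradient_lipschitz_around f L x \<longleftrightarrow>
    (\<exists>U. open U \<and> x \<in> U \<and> (\<forall>u\<in>U. \<exists>v. has_gradient f u v) \<and> L-lipschitz_on U (gradient f))"

definition regular_subdiff :: "('a::real_inner \<Rightarrow> ereal) \<Rightarrow> 'a \<Rightarrow> 'a set" where
  "regular_subdiff f x =
    {v. \<bar>f x\<bar> \<noteq> \<infinity> \<and>
        0 \<le> Liminf (at x) (\<lambda>u. (f u - f x - ereal (v \<bullet> (u - x))) / ereal (norm (u - x)))}"

definition limiting_subdiff :: "('a::real_inner \<Rightarrow> ereal) \<Rightarrow> 'a \<Rightarrow> 'a set" where
  "limiting_subdiff f x =
    {v. \<bar>f x\<bar> \<noteq> \<infinity> \<and>
        (\<exists>xs vs. xs \<longlonglongrightarrow> x \<and> (\<lambda>k. f (xs k)) \<longlonglongrightarrow> f x \<and>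
                 (\<forall>k. vs k \<in> regular_subdiff f (xs k)) \<and> vs \<longlonglongrightarrow> v)}"

definition symmetric_subdiff :: "('a::real_inner \<Rightarrow> ereal) \<Rightarrow> 'a \<Rightarrow> 'a set" where
  "symmetric_subdiff f x = limiting_subdiff f x \<union> uminus ` limiting_subdiff (\<lambda>u. - f u) x"

text \<open>Unlike \<open>infdist\<close>, the distance to the empty set is \<open>\<infinity>\<close>.\<close>

definition edist_to :: "'a::metric_space \<Rightarrow> 'a set \<Rightarrow> ereal" where
  "edist_to x S = (INF w\<in>S. ereal (dist x w))"

definition symmetric_PLK_with ::
  "('a::real_inner \<Rightarrow> ereal) \<Rightarrow> 'a \<Rightarrow> real \<Rightarrow> (real \<Rightarrow> real) \<Rightarrow> bool" where
  "symmetric_PLK_with \<phi> xb \<eta> \<psi> \<longleftrightarrow>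
    finite_near \<phi> xb \<and> (\<exists>V. open V \<and> xb \<in> V \<and> continuous_on V \<phi>) \<and>
    0 < \<eta> \<and> \<psi> ` {0..\<eta>} \<subseteq> {0..} \<and> concave_on {0..\<eta>} \<psi> \<and> continuous_on {0..\<eta>} \<psi> \<and> \<psi> 0 = 0 \<and>
    \<psi> C1_differentiable_on {0<..<\<eta>} \<and> (\<forall>t\<in>{0<..<\<eta>}. 0 < deriv \<psi> t) \<and>
    (\<exists>U. open U \<and> xb \<in> U \<and>
      (\<forall>x\<in>U. \<phi> xb < \<phi> x \<and> \<phi> x < \<phi> xb + ereal \<eta> \<longrightarrow>
        1 \<le> ereal (deriv \<psi> (real_of_ereal (\<phi> x - \<phi> xb))) * edist_to 0 (symmetric_subdiff \<phi> x)))"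

definition symmetric_PLK :: "('a::real_inner \<Rightarrow> ereal) \<Rightarrow> 'a \<Rightarrow> bool" where
  "symmetric_PLK \<phi> xb \<longleftrightarrow> (\<exists>\<eta> \<psi>. symmetric_PLK_with \<phi> xb \<eta> \<psi>)"

definition symmetric_PLK_exponent ::
  "('a::real_inner \<Rightarrow> ereal) \<Rightarrow> 'a \<Rightarrow> real \<Rightarrow> real \<Rightarrow> bool" where
  "symmetric_PLK_exponent \<phi> xb M q \<longleftrightarrow>
    (\<exists>\<eta>. symmetric_PLK_with \<phi> xb \<eta> (\<lambda>t. M * t powr (1 - q)))"

text \<open>The stepsize returned by the while loop started at \<open>l0\<close>: the first \<open>\<beta> ^ m * l0\<close> for
  which the loop condition fails. In particular, the loop is assumed to terminate.\<close>

definition backtracking ::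
  "('a::real_normed_vector \<Rightarrow> ereal) \<Rightarrow> real \<Rightarrow> real \<Rightarrow> 'a \<Rightarrow> 'a \<Rightarrow> real \<Rightarrow> real \<Rightarrow> bool" where
  "backtracking \<phi> \<alpha> \<beta> y d l0 l \<longleftrightarrow>
    (let continue = (\<lambda>s. \<phi> (y + s *\<^sub>R d) > \<phi> y - ereal (\<alpha> * s\<^sup>2 * (norm d)\<^sup>2))
     in \<exists>m. l = \<beta> ^ m * l0 \<and> \<not> continue l \<and> (\<forall>j<m. continue (\<beta> ^ j * l0)))"

text \<open>\<open>bdca g h \<alpha> \<beta> x u y l0 l\<close>: a run of the algorithm for \<open>g - h\<close> with iterates \<open>x k\<close>,
  subgradients \<open>u k\<close>, subproblem solutions \<open>y k\<close>, initial stepsizes \<open>l0 k\<close> and accepted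
  stepsizes \<open>l k\<close>. Both stopping tests make the continued sequence satisfy
  \<open>x (Suc j) = x j\<close>, and the run is still active at \<open>k\<close> iff this holds for no \<open>j < k\<close>.
  The second test, \<open>y k + l k *\<^sub>R (y k - x k) = x k\<close>, never succeeds for \<open>y k \<noteq> x k\<close>,
  as \<open>l k \<ge> 0\<close>. After stopping, \<open>u k\<close> and \<open>l0 k\<close> are irrelevant and \<open>y k\<close> is set to \<open>x k\<close>.\<close>

definition bdca ::
  "('a::real_inner \<Rightarrow> ereal) \<Rightarrow> ('a \<Rightarrow> ereal) \<Rightarrow> real \<Rightarrow> real \<Rightarrow> (nat \<Rightarrow> 'a) \<Rightarrow> (nat \<Rightarrow> 'a) \<Rightarrow>
   (nat \<Rightarrow> 'a) \<Rightarrow> (nat \<Rightarrow> real) \<Rightarrow> (nat \<Rightarrow> real) \<Rightarrow> bool" where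
  "bdca g h \<alpha> \<beta> x u y l0 l \<longleftrightarrow>
    (\<forall>k. if \<exists>j<k. x (Suc j) = x j
         then y k = x k \<and> x (Suc k) = x k \<and> l k = 0
         else u k \<in> convex_subdiff h (x k) \<and>
              {z. is_arg_min (\<lambda>v. g v - ereal (u k \<bullet> v)) (\<lambda>_. True) z} = {y k} \<and>
              (if y k = x k
               then x (Suc k) = x k \<and> l k = 0
               else 0 \<le> l0 k \<and>
                    backtracking (\<lambda>v. g v - h v) \<alpha> \<beta> (y k) (y k - x k) (l0 k) (l k) \<and>
                    x (Suc k) = y k + l k *\<^sub>R (y k - x k)))"

end

theory Submission
  imports Defs
begin

text \<open>The proof combines a sufficient decrease of \<open>\<phi> = g - h\<close> along the iterates, a bound on some
  symmetric subgradient by the step length, and the Kurdyka-Lojasiewicz argument.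

  \<^emph>\<open>Decrease.\<close> The point \<open>y k\<close> minimises \<open>g - \<langle>p, \<cdot>\<rangle>\<close> for some \<open>p \<in> \<partial>h (x k)\<close>, so \<open>p\<close> is a
  subgradient of \<open>g\<close> at \<open>y k\<close>. Strong convexity turns both subgradient inequalities into
  inequalities with an extra term \<open>\<rho>/2 \<parallel>y k - x k\<parallel>\<^sup>2\<close>; their sum gives
  \<open>\<phi> (y k) \<le> \<phi> (x k) - \<rho> \<parallel>y k - x k\<parallel>\<^sup>2\<close> (\<open>sufficient_decrease\<close>), and the linesearch lowers \<open>\<phi>\<close> further.
  Since \<open>x (Suc k) - x k = (1 + l k) (y k - x k)\<close>, this is the stated estimate. Its coefficient
  \<open>(\<alpha> t\<^sup>2 + \<rho>) / (1 + t)\<^sup>2\<close> is at least \<open>c = \<alpha> \<rho> / (\<alpha> + \<rho>) > 0\<close> for every \<open>t \<ge> 0\<close>, however large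
  the stepsizes are. Hence the steps tend to \<open>0\<close>, and so does \<open>y k - x k\<close>.

  \<^emph>\<open>Subgradients.\<close> Where \<open>g\<close> is smooth, subtracting or adding \<open>\<nabla>g\<close> turns regular subgradients of \<open>\<phi>\<close> or \<open>-\<phi>\<close>
  into those of \<open>-h\<close> or \<open>h\<close>, and a regular subgradient of a convex function or of its negative is, up to sign, a
  subgradient of convex analysis. The graph of \<open>\<partial>h\<close> is closed, whence the formula
  \<open>\<nabla>g - \<partial>h\<close> for the symmetric subdifferential (\<open>symmetric_subdiff_difference\<close>). Near \<open>xb\<close> the
  optimality of \<open>y k\<close> reads \<open>p = \<nabla>g (y k)\<close>, so \<open>\<nabla>g (x k) - \<nabla>g (y k)\<close> is a symmetric subgradient at
  \<open>x k\<close> whose norm is at most \<open>L \<parallel>y k - x k\<parallel>\<close>. Passing to the limit yields stationarity.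

  \<^emph>\<open>Convergence and rates.\<close> Let \<open>s k = \<phi> (x k) - \<phi> (xb)\<close>. The PLK inequality, the subgradient bound and
  concavity of \<open>\<psi>\<close> combine to
  \<open>\<parallel>x (Suc k) - x k\<parallel> \<le> L/c (\<psi> (s k) - \<psi> (s (Suc k)))\<close> as long as \<open>x k\<close> is near \<open>xb\<close>. Such a telescoping
  bound traps the sequence and gives \<open>\<parallel>x k - xb\<parallel> \<le> L/c \<psi> (s k)\<close> (\<open>KL_descent_convergence\<close>). For
  \<open>\<psi> t = M t powr (1 - q)\<close> the same ingredients give
  \<open>s k - s (Suc k) \<ge> \<kappa> s k powr (2 q)\<close>, and the three rates are those of this scalar recursion
  (\<open>KL_exponent_rates\<close>).\<close>

section \<open>Regular subgradients and strong convexity\<close>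

text \<open>Clearing the denominator in the liminf gives a form that is easy to add and to restrict to rays.
  At \<open>w = z\<close> the inequality is trivial, so full neighbourhoods can replace punctured ones.\<close>

lemma regular_subdiff_iff:
  fixes f :: "'a::real_inner \<Rightarrow> ereal"
  shows "v \<in> regular_subdiff f z \<longleftrightarrow> \<bar>f z\<bar> \<noteq> \<infinity> \<and>
    (\<forall>e>0. \<forall>\<^sub>F w in nhds z. f z + ereal (v \<bullet> (w - z) - e * norm (w - z)) \<le> f w)"
    (is "_ \<longleftrightarrow> _ \<and> ?R")
proof (cases "\<bar>f z\<bar> = \<infinity>")
  case True
  then show ?thesis by (simp add: regular_subdiff_def)
next
  case False
  then obtain a where a: "f z = ereal a" by (cases "f z") auto
  define Q where "Q = (\<lambda>w. (f w - f z - ereal (v \<bullet> (w - z))) / ereal (norm (w - z)))"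
  have Q_less: "ereal (- e) < Q w \<longleftrightarrow>
      f z + ereal (v \<bullet> (w - z) - e * norm (w - z)) < f w" if "w \<noteq> z" for w e
  proof -
    have "0 < norm (w - z)" using that by simp
    then show ?thesis unfolding Q_def a
      by (cases "f w") (auto simp: field_simps)
  qed
  have "v \<in> regular_subdiff f z \<longleftrightarrow> 0 \<le> Liminf (at z) Q"
    using False by (simp add: regular_subdiff_def Q_def)
  also have "\<dots> \<longleftrightarrow> (\<forall>y<0. \<forall>\<^sub>F w in at z. y < Q w)"
    by (simp add: le_Liminf_iff)
  also have "\<dots> \<longleftrightarrow> (\<forall>e>0. \<forall>\<^sub>F w in at z. ereal (- e) < Q w)" (is "?A \<longleftrightarrow> ?B")
  proof
    assume ?B
    show ?A
    proof (intro allI impI)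
      fix y :: ereal assume "y < 0"
      then obtain r where r: "y < ereal r" "ereal r < 0"
        using ereal_dense2[of y 0] by auto
      have "- r > 0" using r(2) by simp
      then have "\<forall>\<^sub>F w in at z. ereal (- (- r)) < Q w" using \<open>?B\<close> by blast
      then show "\<forall>\<^sub>F w in at z. y < Q w"
        by (rule eventually_mono) (use r(1) in \<open>auto intro: less_trans\<close>)
    qed
  next
    assume A: ?A
    show ?B
    proof (intro allI impI)
      fix e :: real assume "e > 0"
      then have "ereal (- e) < 0" by simp
      then show "\<forall>\<^sub>F w in at z. ereal (- e) < Q w" using A by blast
    qed
  qed
  also have "\<dots> \<longleftrightarrow> ?R"
  proof
    assume B: ?B
    show ?R
    proof (intro allI impI)
      fix e :: real assume "e > 0"
      then have "\<forall>\<^sub>F w in at z. ereal (- e) < Q w" using B by blast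
      then show "\<forall>\<^sub>F w in nhds z. f z + ereal (v \<bullet> (w - z) - e * norm (w - z)) \<le> f w"
        unfolding eventually_at_filter
      proof (rule eventually_mono)
        fix w assume *: "w \<noteq> z \<longrightarrow> w \<in> UNIV \<longrightarrow> ereal (- e) < Q w"
        show "f z + ereal (v \<bullet> (w - z) - e * norm (w - z)) \<le> f w"
          using * Q_less[of w e] a by (cases "w = z") auto
      qed
    qed
  next
    assume R: ?R
    show ?B
    proof (intro allI impI)
      fix e :: real assume "e > 0"
      then have "\<forall>\<^sub>F w in nhds z. f z + ereal (v \<bullet> (w - z) - (e/2) * norm (w - z)) \<le> f w"
        using R by (meson half_gt_zero)
      then show "\<forall>\<^sub>F w in at z. ereal (- e) < Q w"
        unfolding eventually_at_filter
      proof (rule eventually_mono, intro impI)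
        fix w assume *: "f z + ereal (v \<bullet> (w - z) - (e/2) * norm (w - z)) \<le> f w" and w: "w \<noteq> z"
        \<comment> \<open>the liminf condition asks for a strict inequality, which halving \<open>e\<close> provides\<close>
        have "0 < e / 2 * norm (w - z)" using w \<open>e > 0\<close> by simp
        then have "f z + ereal (v \<bullet> (w - z) - e * norm (w - z)) < f z + ereal (v \<bullet> (w - z) - (e/2) * norm (w - z))"
          unfolding a by simp
        then show "ereal (- e) < Q w" unfolding Q_less[OF w, of e] using * by (rule less_le_trans)
      qed
    qed
  qed
  finally show ?thesis using False by simp
qed

lemma GDERIV_eventually_bound:
  fixes G :: "'a::real_inner \<Rightarrow> real"
  assumes "GDERIV G z :> a" "e > 0"
  shows "\<forall>\<^sub>F w in nhds z. \<bar>G w - G z - a \<bullet> (w - z)\<bar> \<le> e * norm (w - z)"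
proof -
  obtain d where d: "d > 0"
      "\<And>w. norm (w - z) < d \<Longrightarrow> norm (G w - G z - (w - z) \<bullet> a) \<le> e * norm (w - z)"
    using assms unfolding gderiv_def has_derivative_at_alt by blast
  then show ?thesis
    unfolding eventually_nhds_metric
    by (intro exI[of _ d]) (auto simp: dist_norm inner_commute)
qed

text \<open>The equation between \<open>f1\<close> and \<open>f2\<close> is required only near \<open>z\<close>, because the functions in question
  differ where \<open>g\<close> is infinite. Applying the lemma with \<open>G\<close> and with \<open>-G\<close> gives both inclusions of
  the sum rule.\<close>

lemma regular_subdiff_add_smooth:
  fixes f1 f2 :: "'a::real_inner \<Rightarrow> ereal"
  assumes G: "GDERIV G z :> a" and eq: "\<forall>\<^sub>F w in nhds z. f2 w = f1 w + ereal (G w)"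
    and p: "p \<in> regular_subdiff f1 z"
  shows "p + a \<in> regular_subdiff f2 z"
proof -
  have fin: "\<bar>f1 z\<bar> \<noteq> \<infinity>" and
    *: "\<And>e. e > 0 \<Longrightarrow> \<forall>\<^sub>F w in nhds z. f1 z + ereal (p \<bullet> (w - z) - e * norm (w - z)) \<le> f1 w"
    using p by (auto simp: regular_subdiff_iff)
  have z: "f2 z = f1 z + ereal (G z)" using eq eventually_nhds_x_imp_x by blast
  obtain c where c: "f1 z = ereal c" using fin by (cases "f1 z") auto
  show ?thesis unfolding regular_subdiff_iff
  proof (intro conjI allI impI)
    fix e :: real assume "e > 0"
    then have e2: "e / 2 > 0" by simp
    show "\<forall>\<^sub>F w in nhds z. f2 z + ereal ((p + a) \<bullet> (w - z) - e * norm (w - z)) \<le> f2 w"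
      using eq *[OF e2] GDERIV_eventually_bound[OF G e2]
    proof eventually_elim
      case (elim w)
      have "e * norm (w - z) = e / 2 * norm (w - z) + e / 2 * norm (w - z)" by simp
      then have "c + G z + ((p + a) \<bullet> (w - z) - e * norm (w - z))
          \<le> c + (p \<bullet> (w - z) - e / 2 * norm (w - z)) + G w"
        using elim(3) unfolding inner_add_left abs_le_iff by linarith
      with elim(1,2) show ?case unfolding z c by (cases "f1 w") auto
    qed
  qed (use c z in auto)
qed

text \<open>The quadratic gain comes from the identity for \<open>\<parallel>(1 - t) a + t b\<parallel>\<^sup>2\<close>. Finiteness at the end points
  implies finiteness in between, so that later arguments along segments can work in \<open>real\<close>.\<close>

lemma strongly_convex_segment:
  fixes f :: "'a::real_inner \<Rightarrow> ereal"
  assumes f: "strongly_convex \<rho> f" "\<And>v. f v \<noteq> -\<infinity>"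
    and ab: "f a = ereal A" "f b = ereal B" and t: "0 \<le> t" "t \<le> 1"
  shows "\<exists>C. f (a + t *\<^sub>R (b - a)) = ereal C \<and>
     C \<le> (1 - t) * A + t * B - \<rho> / 2 * t * (1 - t) * (norm (b - a))\<^sup>2"
proof -
  let ?m = "a + t *\<^sub>R (b - a)"
  have m: "(1 - t) *\<^sub>R a + t *\<^sub>R b = ?m" by (simp add: algebra_simps)
  have "f ((1 - t) *\<^sub>R a + t *\<^sub>R b) - ereal (\<rho> / 2 * (norm ((1 - t) *\<^sub>R a + t *\<^sub>R b))\<^sup>2)
     \<le> ereal (1 - t) * (f a - ereal (\<rho> / 2 * (norm a)\<^sup>2)) + ereal t * (f b - ereal (\<rho> / 2 * (norm b)\<^sup>2))"
    using f(1) t unfolding strongly_convex_def convex_fun_def by blast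
  then have le: "f ?m - ereal (\<rho> / 2 * (norm ?m)\<^sup>2) \<le>
     ereal ((1 - t) * (A - \<rho> / 2 * (norm a)\<^sup>2) + t * (B - \<rho> / 2 * (norm b)\<^sup>2))"
    unfolding m ab by simp
  then obtain C where C: "f ?m = ereal C" using f(2)[of ?m] by (cases "f ?m") auto
  have sq: "(norm ?m)\<^sup>2 = (1 - t) * (norm a)\<^sup>2 + t * (norm b)\<^sup>2 - t * (1 - t) * (norm (b - a))\<^sup>2"
    by (simp add: power2_norm_eq_inner algebra_simps inner_commute)
  from le have "C \<le> (1 - t) * (A - \<rho> / 2 * (norm a)\<^sup>2) + t * (B - \<rho> / 2 * (norm b)\<^sup>2)
      + \<rho> / 2 * (norm ?m)\<^sup>2"
    unfolding C by simp
  also have "\<dots> = (1 - t) * A + t * B - \<rho> / 2 * t * (1 - t) * (norm (b - a))\<^sup>2"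
    unfolding sq by (simp add: field_simps)
  finally show ?thesis using C by blast
qed

text \<open>A local lower estimate at \<open>z\<close> is compared with the convexity estimate at the point
  \<open>z + t (w - z)\<close>; dividing by \<open>t\<close> and letting \<open>t \<rightarrow> 0\<close> makes it global and keeps the full quadratic
  term.\<close>

lemma regular_subgradient_quadratic_growth:
  fixes f :: "'a::real_inner \<Rightarrow> ereal"
  assumes f: "strongly_convex \<rho> f" "\<And>v. f v \<noteq> -\<infinity>" and p: "p \<in> regular_subdiff f z"
  shows "f z + ereal (p \<bullet> (w - z) + \<rho> / 2 * (norm (w - z))\<^sup>2) \<le> f w"
proof (cases "f w")
  case (real B)
  obtain A where A: "f z = ereal A"
    using p by (cases "f z") (auto simp: regular_subdiff_iff)
  define d where "d = norm (w - z)"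
  have ineq: "p \<bullet> (w - z) \<le> B - A - \<rho> / 2 * (1 - t) * d\<^sup>2 + e * d"
    if "0 < t" "t \<le> 1" "f z + ereal (p \<bullet> (z + t *\<^sub>R (w - z) - z) - e * norm (z + t *\<^sub>R (w - z) - z))
      \<le> f (z + t *\<^sub>R (w - z))" for t e
  proof -
    obtain C where C: "f (z + t *\<^sub>R (w - z)) = ereal C"
      "C \<le> (1 - t) * A + t * B - \<rho> / 2 * t * (1 - t) * d\<^sup>2"
      using strongly_convex_segment[OF f A real, of t] \<open>0 < t\<close> \<open>t \<le> 1\<close> unfolding d_def by fastforce
    have "A + (t * (p \<bullet> (w - z)) - e * (t * d)) \<le> C"
      using that C A by (simp add: d_def)
    with C(2) have "t * (p \<bullet> (w - z)) \<le> t * (B - A - \<rho> / 2 * (1 - t) * d\<^sup>2 + e * d)"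
      by (simp add: algebra_simps)
    then show ?thesis using \<open>0 < t\<close> by simp
  qed
  \<comment> \<open>first \<open>t \<rightarrow> 0\<close> for a fixed error \<open>e\<close>, since the admissible \<open>t\<close> depend on \<open>e\<close>; then \<open>e \<rightarrow> 0\<close>\<close>
  have ineq2: "p \<bullet> (w - z) \<le> B - A - \<rho> / 2 * d\<^sup>2 + e * d" if "e > 0" for e
  proof (rule tendsto_lowerbound)
    let ?F = "at_right (0::real)"
    show "((\<lambda>t. B - A - \<rho> / 2 * (1 - t) * d\<^sup>2 + e * d) \<longlongrightarrow> B - A - \<rho> / 2 * d\<^sup>2 + e * d) ?F"
      by (auto intro!: tendsto_eq_intros)
    have "((\<lambda>t. z + t *\<^sub>R (w - z)) \<longlongrightarrow> z) ?F"
      by (auto intro!: tendsto_eq_intros)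
    then have "\<forall>\<^sub>F t in ?F. f z + ereal (p \<bullet> (z + t *\<^sub>R (w - z) - z) - e * norm (z + t *\<^sub>R (w - z) - z))
        \<le> f (z + t *\<^sub>R (w - z))"
      by (rule eventually_compose_filterlim[rotated])
        (use p \<open>e > 0\<close> in \<open>simp add: regular_subdiff_iff\<close>)
    moreover have "\<forall>\<^sub>F t in ?F. 0 < t \<and> t \<le> (1::real)"
      by (auto simp: eventually_at_right_field intro!: exI[of _ 1])
    ultimately show "\<forall>\<^sub>F t in ?F. p \<bullet> (w - z) \<le> B - A - \<rho> / 2 * (1 - t) * d\<^sup>2 + e * d"
      by eventually_elim (rule ineq, auto)
  qed simp
  have "p \<bullet> (w - z) \<le> B - A - \<rho> / 2 * d\<^sup>2"
  proof (rule tendsto_lowerbound)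
    let ?F = "at_right (0::real)"
    show "((\<lambda>e. B - A - \<rho> / 2 * d\<^sup>2 + e * d) \<longlongrightarrow> B - A - \<rho> / 2 * d\<^sup>2) ?F"
      by (auto intro!: tendsto_eq_intros)
    show "\<forall>\<^sub>F e in ?F. p \<bullet> (w - z) \<le> B - A - \<rho> / 2 * d\<^sup>2 + e * d"
      using ineq2 by (auto simp: eventually_at_right_field intro!: exI[of _ 1])
  qed simp
  then show ?thesis unfolding A real d_def by simp
qed (use f in auto)

lemma convex_subdiff_subset_regular_subdiff: "convex_subdiff f z \<subseteq> regular_subdiff f z"
proof
  fix p assume p: "p \<in> convex_subdiff f z"
  then obtain A where A: "f z = ereal A" by (cases "f z") (auto simp: convex_subdiff_def)
  show "p \<in> regular_subdiff f z" unfolding regular_subdiff_iff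
  proof (intro conjI allI impI always_eventually)
    fix e :: real and w assume "e > 0"
    then have "0 \<le> e * norm (w - z)" by simp
    then have "f z + ereal (p \<bullet> (w - z) - e * norm (w - z)) \<le> f z + ereal (p \<bullet> (w - z))"
      unfolding A by simp
    also have "\<dots> \<le> f w" using p by (simp add: convex_subdiff_def)
    finally show "f z + ereal (p \<bullet> (w - z) - e * norm (w - z)) \<le> f w" .
  qed (use A in auto)
qed

lemma regular_subdiff_convex:
  fixes f :: "'a::real_inner \<Rightarrow> ereal"
  assumes f: "strongly_convex \<rho> f" "\<And>v. f v \<noteq> -\<infinity>" and \<rho>: "0 \<le> \<rho>"
  shows "regular_subdiff f z = convex_subdiff f z"
proof (rule antisym[OF subsetI convex_subdiff_subset_regular_subdiff])
  fix p assume p: "p \<in> regular_subdiff f z"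
  then obtain A where A: "f z = ereal A" by (cases "f z") (auto simp: regular_subdiff_iff)
  have "f z + ereal (p \<bullet> (w - z)) \<le> f w" for w
  proof -
    have "f z + ereal (p \<bullet> (w - z)) \<le> f z + ereal (p \<bullet> (w - z) + \<rho> / 2 * (norm (w - z))\<^sup>2)"
      unfolding A using \<rho> by simp
    also have "\<dots> \<le> f w" by (rule regular_subgradient_quadratic_growth[OF f p])
    finally show ?thesis .
  qed
  then show "p \<in> convex_subdiff f z" unfolding convex_subdiff_def using A by simp
qed

text \<open>By midpoint convexity \<open>f w \<ge> 2 f z - f (2 z - w)\<close>, so an upper estimate of \<open>f\<close> at the reflected point
  is a lower estimate at \<open>w\<close>: a subgradient of \<open>-f\<close> is the negative of one of \<open>f\<close>.\<close>

lemma regular_subdiff_uminus_convex: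
  fixes f :: "'a::real_inner \<Rightarrow> ereal"
  assumes f: "strongly_convex \<rho> f" "\<And>v. f v \<noteq> -\<infinity>" and \<rho>: "0 \<le> \<rho>"
    and q: "q \<in> regular_subdiff (\<lambda>v. - f v) z"
  shows "- q \<in> convex_subdiff f z"
proof -
  obtain A where A: "f z = ereal A" using q by (cases "f z") (auto simp: regular_subdiff_iff)
  have "- q \<in> regular_subdiff f z" unfolding regular_subdiff_iff
  proof (intro conjI allI impI)
    fix e :: real assume "e > 0"
    have "((\<lambda>w. z + z - w) \<longlongrightarrow> z) (nhds z)"
      by (auto intro!: tendsto_eq_intros filterlim_ident)
    then have "\<forall>\<^sub>F w in nhds z. - f z + ereal (q \<bullet> (z + z - w - z) - e * norm (z + z - w - z))
        \<le> - f (z + z - w)"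
      by (rule eventually_compose_filterlim[rotated])
        (use q \<open>e > 0\<close> in \<open>simp add: regular_subdiff_iff\<close>)
    then show "\<forall>\<^sub>F w in nhds z. f z + ereal (- q \<bullet> (w - z) - e * norm (w - z)) \<le> f w"
    proof eventually_elim
      case (elim w)
      obtain C where C: "f (z + z - w) = ereal C" 
        using elim f(2)[of "z + z - w"] A by (cases "f (z + z - w)") auto
      have C_le: "C \<le> A + q \<bullet> (w - z) + e * norm (w - z)"
      proof -
        have "q \<bullet> (z + z - w - z) = - (q \<bullet> (w - z))" "norm (z + z - w - z) = norm (w - z)"
          by (simp_all add: inner_diff_right norm_minus_commute)
        with elim show ?thesis unfolding A C by simp
      qed
      show ?case
      proof (cases "f w")
        case (real B)
        have "z + z - w + (1/2) *\<^sub>R (w - (z + z - w)) = z"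
          by (simp add: algebra_simps flip: scaleR_add_left scaleR_2)
        note mid = this
        have "A \<le> (1 - 1/2) * C + 1/2 * B - \<rho> / 2 * (1/2) * (1 - 1/2) * (norm (w - (z + z - w)))\<^sup>2"
          using strongly_convex_segment[OF f C real, of "1/2"] A unfolding mid by auto
        moreover have "0 \<le> \<rho> / 2 * (1/2) * (1 - 1/2) * (norm (w - (z + z - w)))\<^sup>2" using \<rho> by simp
        ultimately have "2 * A \<le> C + B" by simp
        with C_le show ?thesis unfolding A real by simp
      qed (use f in auto)
    qed
  qed (use A in auto)
  then show ?thesis using regular_subdiff_convex[OF f \<rho>] by blast
qed

lemma convex_subdiff_closed:
  fixes f :: "'a::real_inner \<Rightarrow> ereal"
  assumes xs: "xs \<longlonglongrightarrow> z" "(\<lambda>k. f (xs k)) \<longlonglongrightarrow> f z" "\<bar>f z\<bar> \<noteq> \<infinity>"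
    and ps: "ps \<longlonglongrightarrow> p" "\<forall>\<^sub>F k in sequentially. ps k \<in> convex_subdiff f (xs k)"
  shows "p \<in> convex_subdiff f z"
proof -
  have "f z + ereal (p \<bullet> (w - z)) \<le> f w" for w
  proof (rule tendsto_upperbound)
    have "(\<lambda>k. ereal (ps k \<bullet> (w - xs k))) \<longlonglongrightarrow> ereal (p \<bullet> (w - z))"
      by (intro tendsto_intros xs ps)
    then show "(\<lambda>k. f (xs k) + ereal (ps k \<bullet> (w - xs k))) \<longlonglongrightarrow> f z + ereal (p \<bullet> (w - z))"
      using xs(2,3) by (intro tendsto_add_ereal) auto
    show "\<forall>\<^sub>F k in sequentially. f (xs k) + ereal (ps k \<bullet> (w - xs k)) \<le> f w"
      using ps(2) by eventually_elim (auto simp: convex_subdiff_def)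
  qed simp
  then show ?thesis using xs(3) by (simp add: convex_subdiff_def)
qed

section \<open>Differences of convex functions\<close>

lemma finite_near_imp_finite: "finite_near f z \<Longrightarrow> \<bar>f z\<bar> \<noteq> \<infinity>"
  unfolding finite_near_def by (rule eventually_nhds_x_imp_x)

lemma has_gradient_finite: "has_gradient f z a \<Longrightarrow> \<bar>f z\<bar> \<noteq> \<infinity>"
  by (simp add: has_gradient_def finite_near_imp_finite)

lemma gradient_eqI:
  assumes "has_gradient g z a" shows "gradient g z = a"
proof -
  have "b = a" if "has_gradient g z b" for b
  proof -
    have "(\<lambda>w. w \<bullet> b) = (\<lambda>w. w \<bullet> a)"
      using that assms unfolding has_gradient_def gderiv_def by (blast intro: has_derivative_unique)
    then show ?thesis by (metis vector_eq_ldot inner_commute)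
  qed
  then show ?thesis unfolding gradient_def using assms by blast
qed

text \<open>Subtracting the smooth \<open>g\<close> from itself leaves \<open>p - a\<close> as a regular subgradient of the zero
  function, and the subgradient inequality in the direction \<open>p - a\<close> forces it to vanish.\<close>

lemma convex_subgradient_eq_gradient:
  assumes g: "has_gradient g z a" and p: "p \<in> convex_subdiff g z"
  shows "p = a"
proof -
  have "\<forall>\<^sub>F w in nhds z. 0 = g w + ereal (- real_of_ereal (g w))"
    using g unfolding has_gradient_def finite_near_def
    by (auto elim!: eventually_mono simp: ereal_real zero_ereal_def)
  moreover have "GDERIV (\<lambda>w. - real_of_ereal (g w)) z :> - a"
    using g by (simp add: has_gradient_def GDERIV_minus)
  ultimately have "p + - a \<in> regular_subdiff (\<lambda>_. 0) z"
    using p convex_subdiff_subset_regular_subdiff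
    by (intro regular_subdiff_add_smooth[where ?f1.0 = g and G = "\<lambda>w. - real_of_ereal (g w)"]) auto
  moreover have "strongly_convex 0 (\<lambda>_::'a. 0)"
    by (simp add: strongly_convex_def convex_fun_def)
  ultimately have "0 + ereal ((p + - a) \<bullet> (w - z) + 0 / 2 * (norm (w - z))\<^sup>2) \<le> 0" for w
    by (intro regular_subgradient_quadratic_growth[where f = "\<lambda>_. 0"]) auto
  from this[of "z + (p + - a)"] have "(p - a) \<bullet> (p - a) \<le> 0" by (simp add: zero_ereal_def)
  then have "(p - a) \<bullet> (p - a) = 0" using inner_ge_zero[of "p - a"] by (rule order.antisym)
  then show ?thesis by simp
qed

lemma regular_subdiff_subset_limiting_subdiff: "regular_subdiff f z \<subseteq> limiting_subdiff f z"
proof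
  fix v assume v: "v \<in> regular_subdiff f z"
  then have "\<bar>f z\<bar> \<noteq> \<infinity>" by (simp add: regular_subdiff_iff)
  with v show "v \<in> limiting_subdiff f z"
    unfolding limiting_subdiff_def
    by (intro CollectI conjI exI[of _ "\<lambda>_. z"] exI[of _ "\<lambda>_. v"]) auto
qed

text \<open>The single modulus \<open>\<rho>\<close> serves both functions; \<open>\<rho> = 0\<close> covers plain convexity.\<close>

locale dc_function =
  fixes g h \<phi> :: "'a::real_inner \<Rightarrow> ereal" and \<rho> :: real
  assumes g_bot: "g v \<noteq> -\<infinity>" and h_bot: "h v \<noteq> -\<infinity>"
    and \<phi>_eq: "\<phi> v = g v - h v" and \<phi>_bot: "\<phi> v \<noteq> -\<infinity>"
    and \<rho>: "0 \<le> \<rho>" and g_convex: "strongly_convex \<rho> g" and h_convex: "strongly_convex \<rho> h"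
begin

text \<open>A point with finite \<open>g\<close> and infinite \<open>h\<close> would give \<open>\<phi> = -\<infinity>\<close>; so wherever \<open>g\<close> is finite, all
  computations take place in \<open>real\<close>.\<close>

lemma finite_h: "\<bar>g v\<bar> \<noteq> \<infinity> \<Longrightarrow> \<bar>h v\<bar> \<noteq> \<infinity>"
  using \<phi>_eq[of v] \<phi>_bot[of v] h_bot[of v] by (cases "g v"; cases "h v") auto

lemma finite_\<phi>: "\<bar>g v\<bar> \<noteq> \<infinity> \<Longrightarrow> \<bar>\<phi> v\<bar> \<noteq> \<infinity>"
  using finite_h[of v] unfolding \<phi>_eq by (cases "g v"; cases "h v") auto

lemma regular_subdiff_difference:
  assumes g: "has_gradient g z a" and v: "v \<in> regular_subdiff \<phi> z"
  shows "a - v \<in> convex_subdiff h z"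
proof -
  have "\<forall>\<^sub>F w in nhds z. - h w = \<phi> w + ereal (- real_of_ereal (g w))"
    using g unfolding has_gradient_def finite_near_def
  proof (elim conjE eventually_mono)
    fix w assume "\<bar>g w\<bar> \<noteq> \<infinity>"
    then show "- h w = \<phi> w + ereal (- real_of_ereal (g w))"
      using finite_h[of w] unfolding \<phi>_eq by (cases "g w"; cases "h w") auto
  qed
  moreover have "GDERIV (\<lambda>w. - real_of_ereal (g w)) z :> - a"
    using g by (simp add: has_gradient_def GDERIV_minus)
  ultimately have "v + - a \<in> regular_subdiff (\<lambda>w. - h w) z"
    using v by (intro regular_subdiff_add_smooth[where ?f1.0 = \<phi> and G = "\<lambda>w. - real_of_ereal (g w)"])
  then have "- (v + - a) \<in> convex_subdiff h z"
    by (rule regular_subdiff_uminus_convex[OF h_convex h_bot \<rho>])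
  then show ?thesis by simp
qed

lemma regular_subdiff_minus_difference:
  assumes g: "has_gradient g z a"
  shows "v \<in> regular_subdiff (\<lambda>w. - \<phi> w) z \<longleftrightarrow> v + a \<in> convex_subdiff h z"
proof -
  have G: "GDERIV (\<lambda>w. real_of_ereal (g w)) z :> a"
    and G': "GDERIV (\<lambda>w. - real_of_ereal (g w)) z :> - a"
    using g by (auto simp: has_gradient_def GDERIV_minus)
  have "\<forall>\<^sub>F w in nhds z. h w = - \<phi> w + ereal (real_of_ereal (g w)) \<and>
      - \<phi> w = h w + ereal (- real_of_ereal (g w))"
    using g unfolding has_gradient_def finite_near_def
  proof (elim conjE eventually_mono)
    fix w assume "\<bar>g w\<bar> \<noteq> \<infinity>"
    then show "h w = - \<phi> w + ereal (real_of_ereal (g w)) \<and> - \<phi> w = h w + ereal (- real_of_ereal (g w))"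
      using finite_h[of w] unfolding \<phi>_eq by (cases "g w"; cases "h w") auto
  qed
  then have "\<forall>\<^sub>F w in nhds z. h w = - \<phi> w + ereal (real_of_ereal (g w))"
    and "\<forall>\<^sub>F w in nhds z. - \<phi> w = h w + ereal (- real_of_ereal (g w))"
    by (auto elim: eventually_mono)
  with regular_subdiff_add_smooth[OF G this(1), of v]
    regular_subdiff_add_smooth[OF G' this(2), of "v + a"]
  show ?thesis unfolding regular_subdiff_convex[OF h_convex h_bot \<rho>] by auto
qed

lemma gradient_minus_subgradient_symmetric:
  assumes "has_gradient g z a" and "p \<in> convex_subdiff h z"
  shows "a - p \<in> symmetric_subdiff \<phi> z"
proof -
  have "p - a \<in> regular_subdiff (\<lambda>w. - \<phi> w) z"
    using regular_subdiff_minus_difference[OF assms(1)] assms(2) by simp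
  then have "- (p - a) \<in> uminus ` limiting_subdiff (\<lambda>w. - \<phi> w) z"
    using regular_subdiff_subset_limiting_subdiff by blast
  then show ?thesis by (simp add: symmetric_subdiff_def)
qed

text \<open>Continuity of \<open>h\<close> is read off from \<open>h = g - \<phi>\<close>.\<close>

lemma isCont_h:
  assumes g: "has_gradient g z a" and \<phi>: "isCont \<phi> z"
  shows "isCont h z"
proof -
  have fin: "\<forall>\<^sub>F w in nhds z. \<bar>g w\<bar> \<noteq> \<infinity>"
    using g by (simp add: has_gradient_def finite_near_def)
  have "isCont (\<lambda>w. real_of_ereal (g w)) z"
    using g unfolding has_gradient_def gderiv_def by (blast intro: has_derivative_continuous)
  then have "((\<lambda>w. ereal (real_of_ereal (g w))) \<longlongrightarrow> ereal (real_of_ereal (g z))) (nhds z)"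
    by (simp add: isCont_def tendsto_at_iff_tendsto_nhds[where g = "\<lambda>w. real_of_ereal (g w)"])
  then have "((\<lambda>w. ereal (real_of_ereal (g w)) - \<phi> w) \<longlongrightarrow> ereal (real_of_ereal (g z)) - \<phi> z) (nhds z)"
    using \<phi> has_gradient_finite[OF g] finite_\<phi>
    by (intro tendsto_diff_ereal) (auto simp: isCont_def tendsto_at_iff_tendsto_nhds)
  moreover have eq: "\<forall>\<^sub>F w in nhds z. ereal (real_of_ereal (g w)) - \<phi> w = h w"
    using fin
  proof eventually_elim
    case (elim w)
    then show ?case
      using finite_h[of w] unfolding \<phi>_eq by (cases "g w"; cases "h w") auto
  qed
  ultimately have "(h \<longlongrightarrow> ereal (real_of_ereal (g z)) - \<phi> z) (nhds z)"
    by (simp add: tendsto_cong)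
  then show ?thesis
    unfolding isCont_def tendsto_at_iff_tendsto_nhds using eventually_nhds_x_imp_x[OF eq] by simp
qed

text \<open>A regular subgradient of \<open>\<phi>\<close> or of \<open>-\<phi>\<close> near \<open>z\<close> corresponds to a subgradient of \<open>h\<close> at the same
  point, and limits stay in \<open>\<partial>h z\<close> by continuity of \<open>\<nabla>g\<close> and \<open>h\<close>. Conversely, every element of \<open>\<partial>h z\<close>
  yields a regular subgradient of \<open>-\<phi>\<close>; the part coming from \<open>-\<phi>\<close> therefore already exhausts the right-hand side.\<close>

lemma symmetric_subdiff_difference:
  assumes U: "open U" "z \<in> U" and g: "\<And>w. w \<in> U \<Longrightarrow> \<exists>v. has_gradient g w v"
    and cont: "continuous_on U (gradient g)" and \<phi>: "isCont \<phi> z"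
  shows "symmetric_subdiff \<phi> z = (\<lambda>p. gradient g z - p) ` convex_subdiff h z"
proof -
  have grad: "has_gradient g w (gradient g w)" if "w \<in> U" for w
    using g[OF that] gradient_eqI by metis
  have h: "isCont h z" and h_fin: "\<bar>h z\<bar> \<noteq> \<infinity>"
    using isCont_h[OF grad \<phi>] finite_h has_gradient_finite[OF grad] U by auto
  have closed: "p \<in> convex_subdiff h z"
    if xs: "xs \<longlonglongrightarrow> z" and ps: "(\<lambda>k. ps k + gradient g (xs k)) \<longlonglongrightarrow> p"
      and sub: "\<And>k. xs k \<in> U \<Longrightarrow> ps k + gradient g (xs k) \<in> convex_subdiff h (xs k)" for xs ps p
  proof (rule convex_subdiff_closed[where f = h, OF xs _ h_fin ps])
    show "(\<lambda>k. h (xs k)) \<longlonglongrightarrow> h z" using h xs by (rule isCont_tendsto_compose)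
    show "\<forall>\<^sub>F k in sequentially. ps k + gradient g (xs k) \<in> convex_subdiff h (xs k)"
      using topological_tendstoD[OF xs U] by eventually_elim (rule sub)
  qed
  have grad_lim: "(\<lambda>k. gradient g (xs k)) \<longlonglongrightarrow> gradient g z" if "xs \<longlonglongrightarrow> z" for xs
  proof -
    have "isCont (gradient g) z" using cont U continuous_on_eq_continuous_at by blast
    then show ?thesis using that by (rule isCont_tendsto_compose)
  qed
  show ?thesis
  proof (intro equalityI subsetI)
    fix v assume "v \<in> symmetric_subdiff \<phi> z"
    then consider "v \<in> limiting_subdiff \<phi> z" | "- v \<in> limiting_subdiff (\<lambda>w. - \<phi> w) z"
      unfolding symmetric_subdiff_def by auto
    then have "gradient g z - v \<in> convex_subdiff h z"
    proof cases
      case 1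
      then obtain xs vs where xs: "xs \<longlonglongrightarrow> z" "vs \<longlonglongrightarrow> v"
        and vs: "\<And>k. vs k \<in> regular_subdiff \<phi> (xs k)"
        unfolding limiting_subdiff_def by blast
      show ?thesis
      proof (rule closed[OF xs(1), of "\<lambda>k. - vs k"])
        show "(\<lambda>k. - vs k + gradient g (xs k)) \<longlonglongrightarrow> gradient g z - v"
          using tendsto_diff[OF grad_lim[OF xs(1)] xs(2)] by simp
        show "- vs k + gradient g (xs k) \<in> convex_subdiff h (xs k)" if "xs k \<in> U" for k
          using regular_subdiff_difference[OF grad[OF that] vs] by simp
      qed
    next
      case 2
      then obtain xs vs where xs: "xs \<longlonglongrightarrow> z" "vs \<longlonglongrightarrow> - v"
        and vs: "\<And>k. vs k \<in> regular_subdiff (\<lambda>w. - \<phi> w) (xs k)"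
        unfolding limiting_subdiff_def by blast
      show ?thesis
      proof (rule closed[OF xs(1), of vs])
        show "(\<lambda>k. vs k + gradient g (xs k)) \<longlonglongrightarrow> gradient g z - v"
          using tendsto_add[OF grad_lim[OF xs(1)] xs(2)] by (simp add: add.commute)
        show "vs k + gradient g (xs k) \<in> convex_subdiff h (xs k)" if "xs k \<in> U" for k
          using regular_subdiff_minus_difference[OF grad[OF that]] vs[of k] by simp
      qed
    qed
    then show "v \<in> (\<lambda>p. gradient g z - p) ` convex_subdiff h z"
      by (rule rev_image_eqI) simp
  qed (use gradient_minus_subgradient_symmetric[OF grad[OF U(2)]] in blast)
qed

text \<open>Minimality makes \<open>p\<close> a common subgradient of \<open>h\<close> at \<open>z\<close> and of \<open>g\<close> at \<open>y\<close>. In the sum of the two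
  growth inequalities the linear terms cancel, and each contributes \<open>\<rho>/2\<close>.\<close>

lemma sufficient_decrease:
  assumes p: "p \<in> convex_subdiff h z"
    and y: "is_arg_min (\<lambda>v. g v - ereal (p \<bullet> v)) (\<lambda>_. True) y"
    and fin: "\<bar>g z\<bar> \<noteq> \<infinity>" "\<bar>g y\<bar> \<noteq> \<infinity>"
  shows "p \<in> convex_subdiff g y" and "\<phi> y \<le> \<phi> z - ereal (\<rho> * (norm (y - z))\<^sup>2)"
proof -
  obtain a b c d where ab: "g z = ereal a" "g y = ereal b" and cd: "h z = ereal c" "h y = ereal d"
    using fin finite_h[of z] finite_h[of y] by (auto simp: ereal_infinity_cases)
  have "g y - ereal (p \<bullet> y) \<le> g w - ereal (p \<bullet> w)" for w
    using y by (simp add: is_arg_min_linorder)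
  note le = this
  have "g y + ereal (p \<bullet> (w - y)) \<le> g w" for w
    using le[of w] g_bot[of w] unfolding ab by (cases "g w") (auto simp: inner_diff_right)
  then show pg: "p \<in> convex_subdiff g y" using fin(2) by (simp add: convex_subdiff_def)
  have "g y + ereal (p \<bullet> (z - y) + \<rho> / 2 * (norm (z - y))\<^sup>2) \<le> g z"
    using regular_subgradient_quadratic_growth[OF g_convex g_bot] pg
      convex_subdiff_subset_regular_subdiff by blast
  moreover have "h z + ereal (p \<bullet> (y - z) + \<rho> / 2 * (norm (y - z))\<^sup>2) \<le> h y"
    using regular_subgradient_quadratic_growth[OF h_convex h_bot] p
      convex_subdiff_subset_regular_subdiff by blast
  ultimately show "\<phi> y \<le> \<phi> z - ereal (\<rho> * (norm (y - z))\<^sup>2)"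
    unfolding \<phi>_eq ab cd by (simp add: norm_minus_commute[of z y] inner_diff_right)
qed

end

section \<open>Runs of the algorithm\<close>

text \<open>One statement for all indices spares the later arguments a distinction between active and stopped
  runs. After stopping at the first index \<open>j\<close> with \<open>x (Suc j) = x j\<close>, the subgradient chosen at \<open>j\<close> still works: there \<open>y j = x j\<close>,
  because \<open>1 + l j > 0\<close>, and the iterates are constant from \<open>j\<close> on.\<close>

lemma bdca_step:
  assumes run: "bdca g h \<alpha> \<beta> x u y l0 l" and \<beta>: "0 \<le> \<beta>"
  obtains p where "p \<in> convex_subdiff h (x k)"
    "is_arg_min (\<lambda>v. g v - ereal (p \<bullet> v)) (\<lambda>_. True) (y k)"
    "0 \<le> l k" "x (Suc k) = x k + (1 + l k) *\<^sub>R (y k - x k)"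
    "g (x (Suc k)) - h (x (Suc k)) \<le> g (y k) - h (y k) - ereal (\<alpha> * (l k)\<^sup>2 * (norm (y k - x k))\<^sup>2)"
proof -
  define stopped where "stopped = (\<lambda>k. \<exists>j<k. x (Suc j) = x j)"
  have step: "if stopped k then y k = x k \<and> x (Suc k) = x k \<and> l k = 0
     else u k \<in> convex_subdiff h (x k) \<and>
       {z. is_arg_min (\<lambda>v. g v - ereal (u k \<bullet> v)) (\<lambda>_. True) z} = {y k} \<and>
       (if y k = x k then x (Suc k) = x k \<and> l k = 0
        else 0 \<le> l0 k \<and> backtracking (\<lambda>v. g v - h v) \<alpha> \<beta> (y k) (y k - x k) (l0 k) (l k) \<and>
          x (Suc k) = y k + l k *\<^sub>R (y k - x k))" for k
    unfolding stopped_def by (rule run[unfolded bdca_def, rule_format])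
  have after: "y k = x k \<and> x (Suc k) = x k \<and> l k = 0" if "stopped k" for k
    by (rule step[of k, unfolded if_P[OF that]])
  have "u k \<in> convex_subdiff h (x k) \<and>
      {z. is_arg_min (\<lambda>v. g v - ereal (u k \<bullet> v)) (\<lambda>_. True) z} = {y k} \<and>
      (if y k = x k then x (Suc k) = x k \<and> l k = 0
       else 0 \<le> l0 k \<and> backtracking (\<lambda>v. g v - h v) \<alpha> \<beta> (y k) (y k - x k) (l0 k) (l k) \<and>
         x (Suc k) = y k + l k *\<^sub>R (y k - x k))" if "\<not> stopped k" for k
    by (rule step[of k, unfolded if_not_P[OF that]])
  note active = this[THEN conjunct1] this[THEN conjunct2, THEN conjunct1]
    this[THEN conjunct2, THEN conjunct2]
  have argmin: "is_arg_min (\<lambda>v. g v - ereal (u k \<bullet> v)) (\<lambda>_. True) (y k)" if "\<not> stopped k" for k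
    using active(2)[OF that] by blast
  have l_nonneg: "0 \<le> l k" if "\<not> stopped k" for k
    using active(3)[OF that] \<beta> by (auto simp: backtracking_def Let_def split: if_splits)
  have next_x: "x (Suc k) = x k + (1 + l k) *\<^sub>R (y k - x k)" if "\<not> stopped k" for k
    using active(3)[OF that] by (auto simp: algebra_simps split: if_splits)
  show thesis
  proof (cases "stopped k")
    case False
    have "g (x (Suc k)) - h (x (Suc k)) \<le> g (y k) - h (y k) - ereal (\<alpha> * (l k)\<^sup>2 * (norm (y k - x k))\<^sup>2)"
      using active(3)[OF False]
      by (auto simp: backtracking_def Let_def not_less split: if_splits)
    then show thesis
      using that active(1) argmin l_nonneg next_x False by blast
  next
    case True
    then obtain i where i: "i < k" "x (Suc i) = x i" by (auto simp: stopped_def)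
    then have "\<exists>j. x (Suc j) = x j" by blast
    then obtain j where j1: "x (Suc j) = x j" "\<forall>m<j. x (Suc m) \<noteq> x m"
      by (subst (asm) exists_least_iff) blast
    then have "\<not> i < j" using i(2) by blast
    then have j: "x (Suc j) = x j" "j < k" "\<not> stopped j"
      using i(1) j1 by (auto simp: stopped_def)
    have yj: "y j = x j"
      using j(1) next_x[OF j(3)] l_nonneg[OF j(3)] by (auto simp: add_nonneg_eq_0_iff)
    have const: "x i = x j" if "j \<le> i" for i
      using that
    proof (induction rule: dec_induct)
      case (step i)
      then show ?case
        using j(1) after[of i] by (cases "i = j") (auto simp: stopped_def le_less)
    qed simp
    have xk: "x k = x j" by (rule const[OF less_imp_le[OF j(2)]])
    have stay: "y k = x k" "x (Suc k) = x k" "l k = 0" using after[OF True] by auto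
    show thesis
    proof (rule that[of "u j"])
      show "u j \<in> convex_subdiff h (x k)" using active(1)[OF j(3)] by (simp only: xk)
      show "is_arg_min (\<lambda>v. g v - ereal (u j \<bullet> v)) (\<lambda>_. True) (y k)"
        using argmin[OF j(3)] by (simp only: stay xk yj)
    qed (simp_all add: stay)
  qed
qed

section \<open>Trapping a sequence by a telescoping bound\<close>

text \<open>The step bound is available only while the sequence stays near \<open>xb\<close>. The quantity
  \<open>\<parallel>x k - xb\<parallel> + a k\<close> does not increase as long as it is below \<open>r\<close>, so once it is below \<open>r\<close> it remains
  there. As \<open>xb\<close> is an accumulation point, the quantity becomes arbitrarily small, hence tends to \<open>0\<close>.
  Summing the steps then bounds the distance to the limit.\<close>

lemma tendsto_of_local_telescoping_bound:
  fixes x :: "nat \<Rightarrow> 'a::real_normed_vector" and a :: "nat \<Rightarrow> real"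
  assumes r: "0 < r"
    and step: "\<forall>\<^sub>F k in sequentially. x k \<in> ball xb r \<longrightarrow> norm (x (Suc k) - x k) \<le> a k - a (Suc k)"
    and a: "a \<longlonglongrightarrow> 0" "\<forall>\<^sub>F k in sequentially. 0 \<le> a k"
    and sub: "strict_mono s" "(x \<circ> s) \<longlonglongrightarrow> xb"
  shows "x \<longlonglongrightarrow> xb" and "\<forall>\<^sub>F k in sequentially. norm (x k - xb) \<le> a k"
proof -
  have "\<forall>\<^sub>F k in sequentially. 0 \<le> a k \<and>
      (norm (x k - xb) < r \<longrightarrow> norm (x (Suc k) - x k) \<le> a k - a (Suc k))"
    using step a(2) by eventually_elim (auto simp: dist_norm norm_minus_commute)
  then obtain N where N: "\<And>k. N \<le> k \<Longrightarrow> norm (x k - xb) < r \<Longrightarrow> norm (x (Suc k) - x k) \<le> a k - a (Suc k)"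
    and a_nonneg: "\<And>k. N \<le> k \<Longrightarrow> 0 \<le> a k"
    by (auto simp: eventually_sequentially)
  define e where "e = (\<lambda>k. norm (x k - xb) + a k)"
  have "(\<lambda>k. norm ((x \<circ> s) k - xb) + (a \<circ> s) k) \<longlonglongrightarrow> norm (xb - xb) + 0"
    by (intro tendsto_intros sub LIMSEQ_subseq_LIMSEQ[OF a(1)])
  then have e_lim: "(\<lambda>k. e (s k)) \<longlonglongrightarrow> 0" by (simp add: e_def comp_def)
  have freq: "\<exists>k\<ge>N. e k < \<epsilon>" if "0 < \<epsilon>" for \<epsilon>
  proof -
    have "\<forall>\<^sub>F k in sequentially. e (s k) < \<epsilon> \<and> N \<le> k"
      using order_tendstoD(2)[OF e_lim that] eventually_ge_at_top[of N] by (rule eventually_conj)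
    then obtain k where "e (s k) < \<epsilon>" "N \<le> k" by (auto simp: eventually_sequentially)
    moreover have "k \<le> s k" using sub(1) by (rule seq_suble)
    ultimately show ?thesis by (meson order_trans)
  qed
  have e_Suc: "e (Suc k) \<le> e k" if "N \<le> k" "e k < r" for k
  proof -
    have "norm (x k - xb) < r" using that a_nonneg[of k] by (simp add: e_def)
    from N[OF that(1) this] norm_triangle_ineq[of "x (Suc k) - x k" "x k - xb"]
    show ?thesis by (simp add: e_def)
  qed
  have mono: "e m \<le> e k" if "N \<le> k" "e k < r" "k \<le> m" for k m
    using that(3)
  proof (induction rule: dec_induct)
    case (step m)
    then show ?case using e_Suc[of m] that by linarith
  qed simp
  have e0: "e \<longlonglongrightarrow> 0"
  proof (rule LIMSEQ_I)
    fix \<epsilon> :: real assume "0 < \<epsilon>"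
    then obtain k where k: "N \<le> k" "e k < min \<epsilon> r" using freq[of "min \<epsilon> r"] r by auto
    have "norm (e m - 0) < \<epsilon>" if "k \<le> m" for m
      using mono[OF k(1) _ that] k a_nonneg[of m] that by (simp add: e_def)
    then show "\<exists>k. \<forall>m\<ge>k. norm (e m - 0) < \<epsilon>" by blast
  qed
  have "(\<lambda>k. norm (x k - xb)) \<longlonglongrightarrow> 0"
  proof (rule tendsto_sandwich[OF _ _ tendsto_const e0])
    show "\<forall>\<^sub>F k in sequentially. norm (x k - xb) \<le> e k"
      using a(2) by eventually_elim (simp add: e_def)
  qed simp
  then show x: "x \<longlonglongrightarrow> xb" using LIM_zero_iff tendsto_norm_zero_iff by blast
  obtain k0 where k0: "N \<le> k0" "e k0 < r" using freq r by blast
  have "norm (x k - xb) \<le> a k" if "k0 \<le> k" for k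
  proof -
    have telescope: "norm (x m - x k) \<le> a k - a m" if "k \<le> m" for m
      using that
    proof (induction rule: dec_induct)
      case (step m)
      have "norm (x m - xb) < r"
        using mono[OF k0, of m] k0 a_nonneg[of m] step.hyps \<open>k0 \<le> k\<close> by (simp add: e_def)
      then have "norm (x (Suc m) - x m) \<le> a m - a (Suc m)"
        using N[of m] k0(1) \<open>k0 \<le> k\<close> step.hyps by simp
      then show ?case
        using step.IH norm_triangle_ineq[of "x (Suc m) - x m" "x m - x k"] by simp
    qed simp
    have "norm (xb - x k) \<le> a k"
    proof (rule tendsto_upperbound)
      show "(\<lambda>m. norm (x m - x k)) \<longlonglongrightarrow> norm (xb - x k)" by (intro tendsto_intros x)
      show "\<forall>\<^sub>F m in sequentially. norm (x m - x k) \<le> a k"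
        using eventually_ge_at_top[of k]
      proof eventually_elim
        case (elim m)
        show ?case using telescope[OF elim] a_nonneg[of m] k0(1) \<open>k0 \<le> k\<close> elim by simp
      qed
    qed simp
    then show ?thesis by (simp add: norm_minus_commute)
  qed
  then show "\<forall>\<^sub>F k in sequentially. norm (x k - xb) \<le> a k"
    by (auto simp: eventually_sequentially)
qed

section \<open>Rates of scalar recursions\<close>

text \<open>Dividing by \<open>s k powr p\<close>, the recursion would keep \<open>s k powr (1 - p)\<close> away from \<open>0\<close>.\<close>

lemma fast_decrease_impossible:
  fixes s :: "nat \<Rightarrow> real"
  assumes \<kappa>: "0 < \<kappa>" and p: "p < 1" and s: "s \<longlonglongrightarrow> 0" "\<And>k. 0 < s k"
  shows "\<not> (\<forall>\<^sub>F k in sequentially. \<kappa> * s k powr p \<le> s k - s (Suc k))"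
proof
  assume "\<forall>\<^sub>F k in sequentially. \<kappa> * s k powr p \<le> s k - s (Suc k)"
  then have "\<forall>\<^sub>F k in sequentially. \<kappa> \<le> s k powr (1 - p)"
  proof eventually_elim
    case (elim k)
    then have "\<kappa> * s k powr p \<le> s k powr (1 - p) * s k powr p"
      using s(2)[of k] s(2)[of "Suc k"] by (simp flip: powr_add)
    then show ?case using s(2)[of k] by simp
  qed
  moreover have "(\<lambda>k. s k powr (1 - p)) \<longlonglongrightarrow> 0 powr (1 - p)"
    using s(1) p less_imp_le[OF s(2)] by (intro tendsto_powr') auto
  then have "(\<lambda>k. s k powr (1 - p)) \<longlonglongrightarrow> 0" by simp
  from order_tendstoD(2)[OF this \<kappa>] have "\<forall>\<^sub>F k in sequentially. s k powr (1 - p) < \<kappa>" .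
  ultimately have "\<forall>\<^sub>F k in sequentially. False" by eventually_elim simp
  then show False by simp
qed

lemma linear_decrease_bound:
  fixes s :: "nat \<Rightarrow> real"
  assumes \<kappa>: "0 < \<kappa>" and s: "\<And>k. 0 < s k"
    and dec: "\<forall>\<^sub>F k in sequentially. \<kappa> * s k \<le> s k - s (Suc k)"
  shows "\<exists>C>0. \<exists>c\<in>{0<..<1}. \<forall>\<^sub>F k in sequentially. s k \<le> C * c ^ k"
proof -
  obtain N where N: "\<And>k. N \<le> k \<Longrightarrow> \<kappa> * s k \<le> s k - s (Suc k)"
    using dec by (auto simp: eventually_sequentially)
  define c where "c = 1 - \<kappa>"
  have cs: "s (Suc k) \<le> c * s k" if "N \<le> k" for k
    using N[OF that] by (simp add: c_def algebra_simps)
  have "0 < c * s N" using cs[of N] s[of "Suc N"] by simp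
  then have c: "0 < c" "c < 1" using s[of N] \<kappa> by (auto simp: zero_less_mult_iff c_def)
  have "s k \<le> s N / c ^ N * c ^ k" if "N \<le> k" for k
    using that
  proof (induction rule: dec_induct)
    case (step k)
    have "c * s k \<le> c * (s N / c ^ N * c ^ k)" using step c by (intro mult_left_mono) auto
    then show ?case using cs[of k] step by (simp add: mult_ac)
  qed (use c in simp)
  moreover have "0 < s N / c ^ N" using s c by simp
  ultimately show ?thesis using c
    by (intro exI[of _ "s N / c ^ N"] conjI bexI[of _ c])
      (auto simp del: times_divide_eq_left simp: eventually_sequentially)
qed

text \<open>By convexity of \<open>t \<mapsto> t powr (- p)\<close>, the recursion makes \<open>s k powr (- p)\<close> grow by at least \<open>p \<kappa>\<close> in
  each step, hence at least linearly in \<open>k\<close>.\<close>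

lemma sublinear_decrease_bound:
  fixes s :: "nat \<Rightarrow> real"
  assumes \<kappa>: "0 < \<kappa>" and p: "0 < p" and s: "\<And>k. 0 < s k"
    and dec: "\<forall>\<^sub>F k in sequentially. \<kappa> * s k powr (p + 1) \<le> s k - s (Suc k)"
  shows "\<exists>C>0. \<forall>\<^sub>F k in sequentially. s k \<le> C * real k powr (- (1 / p))"
proof -
  obtain N where N: "\<And>k. N \<le> k \<Longrightarrow> \<kappa> * s k powr (p + 1) \<le> s k - s (Suc k)"
    using dec by (auto simp: eventually_sequentially)
  have tangent: "s k powr (- p) + p * \<kappa> \<le> s (Suc k) powr (- p)" if "N \<le> k" for k
  proof -
    \<comment> \<open>the tangent inequality for \<open>t \<mapsto> t powr (- p)\<close> at \<open>s k\<close>, from \<open>exp t \<ge> 1 + t\<close> and \<open>ln t \<le> t - 1\<close>\<close>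
    have "ln (s (Suc k)) - ln (s k) \<le> s (Suc k) / s k - 1"
      using s[of k] s[of "Suc k"] ln_le_minus_one[of "s (Suc k) / s k"] by (simp add: ln_div)
    then have "p * (1 - s (Suc k) / s k) \<le> p * (ln (s k) - ln (s (Suc k)))"
      using p by (intro mult_left_mono) auto
    then have "1 + p * (1 - s (Suc k) / s k) \<le> exp (p * (ln (s k) - ln (s (Suc k))))"
      using exp_ge_add_one_self[of "p * (ln (s k) - ln (s (Suc k)))"] by linarith
    then have "s k powr (- p) * (1 + p * (1 - s (Suc k) / s k))
        \<le> s k powr (- p) * exp (p * (ln (s k) - ln (s (Suc k))))"
      by (intro mult_left_mono) auto
    also have "\<dots> = s (Suc k) powr (- p)"
      using s[of k] s[of "Suc k"] by (simp add: powr_def algebra_simps flip: exp_add)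
    also have "s k powr (- p) * (1 + p * (1 - s (Suc k) / s k))
        = s k powr (- p) + p * s k powr (- p - 1) * (s k - s (Suc k))"
      using s[of k] by (simp add: powr_diff field_simps)
    finally have "s k powr (- p) + p * s k powr (- p - 1) * (s k - s (Suc k))
        \<le> s (Suc k) powr (- p)" .
    moreover have "p * s k powr (- p - 1) * (\<kappa> * s k powr (p + 1)) \<le> p * s k powr (- p - 1) * (s k - s (Suc k))"
      using p N[OF that] by (intro mult_left_mono) auto
    moreover have "s k powr (- p - 1) * s k powr (p + 1) = 1"
      using s[of k] by (simp flip: powr_add)
    then have "p * s k powr (- p - 1) * (\<kappa> * s k powr (p + 1)) = p * \<kappa>"
      by (metis mult.assoc mult.commute mult_1_right)
    ultimately show ?thesis by linarith
  qed
  have lower: "p * \<kappa> * (real k - real N) \<le> s k powr (- p)" if "N \<le> k" for k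
    using that
  proof (induction rule: dec_induct)
    case (step k)
    then show ?case using tangent[of k] by (simp add: algebra_simps)
  qed simp
  define C where "C = (p * \<kappa> / 2) powr (- (1 / p))"
  \<comment> \<open>beyond \<open>2 * N\<close>, at least half of the \<open>k\<close> increments have taken effect\<close>
  have "s k \<le> C * real k powr (- (1 / p))" if "k \<ge> 2 * N + 1" for k
  proof -
    have k: "0 < real k" using that by simp
    have "p * \<kappa> / 2 * real k \<le> p * \<kappa> * (real k - real N)"
      using that p \<kappa> by (simp add: field_simps flip: of_nat_mult)
    also have "\<dots> \<le> s k powr (- p)" using lower[of k] that by simp
    finally have "(s k powr (- p)) powr (- (1 / p)) \<le> (p * \<kappa> / 2 * real k) powr (- (1 / p))"
      using p \<kappa> k by (intro powr_mono2') auto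
    also have "(s k powr (- p)) powr (- (1 / p)) = s k" using p s[of k] by (simp add: powr_powr)
    also have "(p * \<kappa> / 2 * real k) powr (- (1 / p)) = C * real k powr (- (1 / p))"
      unfolding C_def by (rule powr_mult)
    finally show ?thesis .
  qed
  moreover have "C > 0" using p \<kappa> by (simp add: C_def)
  ultimately show ?thesis by (auto simp: eventually_sequentially)
qed


section \<open>Descent sequences under a Kurdyka-Lojasiewicz inequality\<close>

lemma concave_on_imp_below_tangent:
  fixes \<psi> :: "real \<Rightarrow> real"
  assumes "concave_on {0..\<eta>} \<psi>" "\<psi> C1_differentiable_on {0<..<\<eta>}" "0 < s" "s < \<eta>" "0 \<le> t" "t \<le> \<eta>"
  shows "deriv \<psi> s * (s - t) \<le> \<psi> s - \<psi> t"
proof -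
  have "\<psi> differentiable at s"
    using assms by (auto simp: C1_differentiable_on_eq)
  then have d: "(\<psi> has_field_derivative deriv \<psi> s) (at s within {0..\<eta>})"
    by (metis DERIV_deriv_iff_real_differentiable has_field_derivative_at_within)
  have "(- deriv \<psi> s) * (t - s) \<le> - \<psi> t - - \<psi> s"
  proof (rule convex_on_imp_above_tangent)
    show "convex_on {0..\<eta>} (\<lambda>x. - \<psi> x)" using assms(1) by (simp add: concave_on_def)
    show "((\<lambda>x. - \<psi> x) has_field_derivative - deriv \<psi> s) (at s within {0..\<eta>})"
      using d by (rule DERIV_minus)
  qed (use assms in auto)
  then show ?thesis by (simp add: algebra_simps)
qed

text \<open>The distance to the symmetric subdifferential is at most the norm of any of its elements, so one
  small symmetric subgradient suffices to exploit the PLK inequality.\<close>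

lemma symmetric_PLK_with_norm_bound:
  assumes PLK: "symmetric_PLK_with \<phi> xb \<eta> \<psi>"
  shows "\<exists>r>0. \<forall>z\<in>ball xb r. \<forall>w\<in>symmetric_subdiff \<phi> z. \<bar>\<phi> z\<bar> \<noteq> \<infinity> \<longrightarrow>
      0 < real_of_ereal (\<phi> z) - real_of_ereal (\<phi> xb) \<longrightarrow>
      real_of_ereal (\<phi> z) - real_of_ereal (\<phi> xb) < \<eta> \<longrightarrow>
      1 \<le> deriv \<psi> (real_of_ereal (\<phi> z) - real_of_ereal (\<phi> xb)) * norm w"
proof -
  have "\<bar>\<phi> xb\<bar> \<noteq> \<infinity>"
    using PLK by (intro finite_near_imp_finite) (simp add: symmetric_PLK_with_def)
  then obtain b where b: "\<phi> xb = ereal b" by auto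
  obtain U where U: "open U" "xb \<in> U"
    "\<And>x. x \<in> U \<Longrightarrow> \<phi> xb < \<phi> x \<Longrightarrow> \<phi> x < \<phi> xb + ereal \<eta> \<Longrightarrow>
      1 \<le> ereal (deriv \<psi> (real_of_ereal (\<phi> x - \<phi> xb))) * edist_to 0 (symmetric_subdiff \<phi> x)"
    using PLK unfolding symmetric_PLK_with_def by blast
  obtain r where r: "0 < r" "ball xb r \<subseteq> U" using U(1,2) open_contains_ball by blast
  have deriv_pos: "0 < deriv \<psi> t" if "0 < t" "t < \<eta>" for t
    using PLK that unfolding symmetric_PLK_with_def by simp
  show ?thesis
  proof (rule exI[of _ r], intro conjI r(1) ballI impI)
    fix z w
    assume z: "z \<in> ball xb r" and w: "w \<in> symmetric_subdiff \<phi> z" and fin: "\<bar>\<phi> z\<bar> \<noteq> \<infinity>"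
      and s: "0 < real_of_ereal (\<phi> z) - real_of_ereal (\<phi> xb)"
        "real_of_ereal (\<phi> z) - real_of_ereal (\<phi> xb) < \<eta>"
    obtain c where c: "\<phi> z = ereal c" using fin by auto
    have "1 \<le> ereal (deriv \<psi> (c - b)) * edist_to 0 (symmetric_subdiff \<phi> z)"
      using U(3)[of z] r(2) z s unfolding b c by auto
    also have "edist_to 0 (symmetric_subdiff \<phi> z) \<le> ereal (norm w)"
      using w by (auto simp: edist_to_def intro: INF_lower2)
    then have "ereal (deriv \<psi> (c - b)) * edist_to 0 (symmetric_subdiff \<phi> z)
        \<le> ereal (deriv \<psi> (c - b)) * ereal (norm w)"
      using deriv_pos[of "c - b"] s unfolding b c by (intro ereal_mult_left_mono) auto
    finally show "1 \<le> deriv \<psi> (real_of_ereal (\<phi> z) - real_of_ereal (\<phi> xb)) * norm w"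
      unfolding b c by simp
  qed
qed

text \<open>With \<open>D\<close> the length of a step, concavity gives \<open>\<psi> (s k) - \<psi> (s (Suc k)) \<ge> \<psi>' (s k) c D\<^sup>2\<close>, and
  \<open>1 \<le> \<psi>' (s k) L D\<close> removes one factor \<open>D\<close> together with the derivative. The result is the
  telescoping bound with \<open>a k = L/c \<psi> (s k)\<close>. No division by \<open>L\<close> occurs, so \<open>L = 0\<close> is covered.\<close>

lemma KL_descent_convergence:
  fixes x :: "nat \<Rightarrow> 'a::real_normed_vector" and s :: "nat \<Rightarrow> real"
  assumes c: "0 < c" and L: "0 \<le> L" and r: "0 < r" and \<eta>: "0 < \<eta>"
    and desc: "\<And>k. c * (norm (x (Suc k) - x k))\<^sup>2 \<le> s k - s (Suc k)"
    and s: "s \<longlonglongrightarrow> 0" "\<And>k. 0 \<le> s k"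
    and \<psi>: "concave_on {0..\<eta>} \<psi>" "\<psi> C1_differentiable_on {0<..<\<eta>}" "continuous_on {0..\<eta>} \<psi>"
      "\<psi> ` {0..\<eta>} \<subseteq> {0..}" "\<psi> 0 = 0"
    and KL: "\<forall>\<^sub>F k in sequentially. x k \<in> ball xb r \<longrightarrow> 0 < s k \<longrightarrow>
      1 \<le> deriv \<psi> (s k) * (L * norm (x (Suc k) - x k))"
    and sub: "strict_mono \<sigma>" "(x \<circ> \<sigma>) \<longlonglongrightarrow> xb"
  shows "x \<longlonglongrightarrow> xb" and "\<forall>\<^sub>F k in sequentially. norm (x k - xb) \<le> L / c * \<psi> (s k)"
proof -
  define a where "a = (\<lambda>k. L / c * \<psi> (s k))"
  have s_less: "\<forall>\<^sub>F k in sequentially. s k < \<eta>" using order_tendstoD(2)[OF s(1) \<eta>] .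
  have "((\<lambda>k. \<psi> (s k)) \<longlongrightarrow> \<psi> 0) sequentially"
  proof (rule continuous_on_tendsto_compose[OF \<psi>(3) s(1)])
    show "\<forall>\<^sub>F k in sequentially. s k \<in> {0..\<eta>}"
      using s_less by eventually_elim (use s(2) in \<open>auto intro: less_imp_le\<close>)
  qed (use \<eta> in simp)
  from tendsto_mult_left[OF this, of "L / c"] have a0: "a \<longlonglongrightarrow> 0"
    unfolding a_def \<psi>(5) by simp
  have a_nonneg: "\<forall>\<^sub>F k in sequentially. 0 \<le> a k"
    using s_less
  proof eventually_elim
    case (elim k)
    then have "\<psi> (s k) \<in> {0..}" using \<psi>(4) s(2)[of k] by fastforce
    then show ?case using c L by (simp add: a_def)
  qed
  have step: "\<forall>\<^sub>F k in sequentially. x k \<in> ball xb r \<longrightarrow> norm (x (Suc k) - x k) \<le> a k - a (Suc k)"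
    using KL s_less
  proof eventually_elim
    case (elim k)
    let ?D = "norm (x (Suc k) - x k)"
    have D: "c * ?D\<^sup>2 \<le> s k - s (Suc k)" by (rule desc)
    have s_Suc: "s (Suc k) \<le> s k" using D c by (smt (verit) mult_nonneg_nonneg zero_le_power2)
    \<comment> \<open>if \<open>s k = 0\<close> the KL inequality says nothing, but then the descent allows no further move\<close>
    have "?D \<le> a k - a (Suc k)" if "x k \<in> ball xb r"
    proof (cases "s k = 0")
      case True
      then have "s (Suc k) = 0" using s_Suc s(2)[of "Suc k"] by simp
      moreover from this have "c * ?D\<^sup>2 \<le> 0" using D True by simp
      then have "?D = 0" using c by (auto simp: mult_le_0_iff)
      ultimately show ?thesis using True by (simp add: a_def)
    next
      case False
      then have sk: "0 < s k" using s(2)[of k] by simp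
      have kl: "1 \<le> deriv \<psi> (s k) * (L * ?D)" using elim(1) that sk by simp
      have "0 \<le> L * ?D" using L by simp
      then have pos: "0 < deriv \<psi> (s k)" using kl by (smt (verit) mult_nonpos_nonneg)
      have "c * ?D = 1 * (c * ?D)" by simp
      also have "\<dots> \<le> deriv \<psi> (s k) * (L * ?D) * (c * ?D)"
        using kl c by (intro mult_right_mono) auto
      also have "\<dots> = L * (deriv \<psi> (s k) * (c * ?D\<^sup>2))" by (simp add: power2_eq_square)
      also have "\<dots> \<le> L * (deriv \<psi> (s k) * (s k - s (Suc k)))"
        using D L pos by (intro mult_left_mono) auto
      also have "\<dots> \<le> L * (\<psi> (s k) - \<psi> (s (Suc k)))"
        using concave_on_imp_below_tangent[OF \<psi>(1,2) sk elim(2), of "s (Suc k)"] s(2)[of "Suc k"]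
          s_Suc elim(2) L by (intro mult_left_mono) auto
      finally show ?thesis using c by (simp add: a_def field_simps)
    qed
    then show ?case by blast
  qed
  show "x \<longlonglongrightarrow> xb" and "\<forall>\<^sub>F k in sequentially. norm (x k - xb) \<le> L / c * \<psi> (s k)"
    using tendsto_of_local_telescoping_bound[OF r step a0 a_nonneg sub] by (simp_all add: a_def)
qed

text \<open>Either \<open>s\<close> reaches \<open>0\<close>, and then the iterates are eventually equal to \<open>xb\<close>, or \<open>s\<close> stays positive and
  squaring the KL inequality and inserting the descent gives \<open>s k - s (Suc k) \<ge> \<kappa> s k powr (2 q)\<close>. The
  three cases are those of the exponent \<open>2 q\<close> below, equal to and above \<open>1\<close>; the bound on \<open>\<parallel>x k - xb\<parallel>\<close> transfers
  the rate from \<open>s\<close> to the iterates.\<close>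

lemma KL_exponent_rates:
  fixes x :: "nat \<Rightarrow> 'a::real_normed_vector" and s :: "nat \<Rightarrow> real"
  assumes c: "0 < c" and A: "0 \<le> A" and B: "0 \<le> B" and q: "0 \<le> q" "q < 1"
    and desc: "\<And>k. c * (norm (x (Suc k) - x k))\<^sup>2 \<le> s k - s (Suc k)"
    and s: "s \<longlonglongrightarrow> 0" "\<And>k. 0 \<le> s k"
    and KL: "\<forall>\<^sub>F k in sequentially. 0 < s k \<longrightarrow> s k powr q \<le> A * norm (x (Suc k) - x k)"
    and bound: "\<forall>\<^sub>F k in sequentially. norm (x k - xb) \<le> B * s k powr (1 - q)"
  shows "q < 1/2 \<Longrightarrow> \<forall>\<^sub>F k in sequentially. x k = xb"
    and "q = 1/2 \<Longrightarrow> \<exists>C>0. \<exists>c\<in>{0<..<1}. \<forall>\<^sub>F k in sequentially. norm (x k - xb) \<le> C * c ^ k"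
    and "1/2 < q \<Longrightarrow> \<exists>C>0. \<forall>\<^sub>F k in sequentially.
      norm (x k - xb) \<le> C * real k powr (- ((1 - q) / (2 * q - 1)))"
proof -
  have s_Suc: "s (Suc k) \<le> s k" for k
    using desc[of k] c by (smt (verit) mult_nonneg_nonneg zero_le_power2)
  consider (stop) "\<forall>\<^sub>F k in sequentially. x k = xb" | (pos) "\<And>k. 0 < s k"
  proof (cases "\<exists>k. s k = 0")
    case True
    then obtain k where k: "s k = 0" by blast
    have "s m = 0" if "k \<le> m" for m
      using lift_Suc_antimono_le[of s, OF s_Suc that] k s(2)[of m] by simp
    then have "\<forall>\<^sub>F m in sequentially. s m = 0" by (auto simp: eventually_sequentially)
    with bound have "\<forall>\<^sub>F m in sequentially. x m = xb" by eventually_elim simp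
    then show ?thesis by (rule stop)
  next
    case False
    then have "0 < s k" for k using s(2)[of k] by (metis order_le_less)
    then show ?thesis by (rule pos)
  qed
  note dichotomy = this
  define \<kappa> where "\<kappa> = c / A\<^sup>2"
  have \<kappa>: "0 < \<kappa>" and decrease: "\<forall>\<^sub>F k in sequentially. \<kappa> * s k powr (2 * q) \<le> s k - s (Suc k)"
    if pos: "\<And>k. 0 < s k"
  proof -
    obtain k where "s k powr q \<le> A * norm (x (Suc k) - x k)"
      using KL pos by (auto simp: eventually_sequentially)
    then have "0 < A" using pos[of k] A by (smt (verit) mult_eq_0_iff powr_gt_zero)
    then show "0 < \<kappa>" using c by (simp add: \<kappa>_def)
    show "\<forall>\<^sub>F k in sequentially. \<kappa> * s k powr (2 * q) \<le> s k - s (Suc k)"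
      using KL
    proof eventually_elim
      case (elim k)
      then have "(s k powr q)\<^sup>2 \<le> (A * norm (x (Suc k) - x k))\<^sup>2"
        using pos by (intro power_mono) auto
      then have "s k powr (2 * q) \<le> A\<^sup>2 * (norm (x (Suc k) - x k))\<^sup>2"
        by (simp add: power2_eq_square power_mult_distrib mult_ac flip: powr_add)
      then have "\<kappa> * s k powr (2 * q) \<le> c * (norm (x (Suc k) - x k))\<^sup>2"
        using \<open>0 < A\<close> c by (simp add: \<kappa>_def field_simps)
      then show ?case using desc[of k] by simp
    qed
  qed
  show "\<forall>\<^sub>F k in sequentially. x k = xb" if "q < 1/2"
    using dichotomy
  proof cases
    case pos
    then show ?thesis
      using fast_decrease_impossible[OF \<kappa> _ s(1), of "2 * q"] decrease that by simp
  qed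
  show "\<exists>C>0. \<exists>c\<in>{0<..<1}. \<forall>\<^sub>F k in sequentially. norm (x k - xb) \<le> C * c ^ k" if "q = 1/2"
    using dichotomy
  proof cases
    case stop
    then have "\<forall>\<^sub>F k in sequentially. norm (x k - xb) \<le> 1 * (1/2) ^ k"
      by eventually_elim simp
    then show ?thesis by (intro exI[of _ 1] conjI bexI[of _ "1/2"]) auto
  next
    case pos
    have "\<forall>\<^sub>F k in sequentially. \<kappa> * s k \<le> s k - s (Suc k)"
      using decrease[OF pos] pos that by (simp add: less_imp_le)
    from linear_decrease_bound[OF \<kappa>[OF pos] pos this]
    obtain C d where C: "0 < C" "0 < d" "d < 1" "\<forall>\<^sub>F k in sequentially. s k \<le> C * d ^ k"
      by auto
    \<comment> \<open>\<open>B + 1\<close> instead of \<open>B\<close>, as the constant must be positive\<close>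
    have "\<forall>\<^sub>F k in sequentially. norm (x k - xb) \<le> ((B + 1) * sqrt C) * sqrt d ^ k"
      using C(4) bound
    proof eventually_elim
      case (elim k)
      have "norm (x k - xb) \<le> B * sqrt (s k)"
        using elim(2) that s(2)[of k] by (simp add: powr_half_sqrt)
      also have "\<dots> \<le> (B + 1) * sqrt (C * d ^ k)"
        using elim(1) B s(2)[of k] by (intro mult_mono) auto
      finally show ?case by (simp add: real_sqrt_mult real_sqrt_power)
    qed
    then show ?thesis using C B
      by (intro exI[of _ "(B + 1) * sqrt C"] conjI bexI[of _ "sqrt d"]) auto
  qed
  show "\<exists>C>0. \<forall>\<^sub>F k in sequentially.
      norm (x k - xb) \<le> C * real k powr (- ((1 - q) / (2 * q - 1)))" if "1/2 < q"
    using dichotomy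
  proof cases
    case stop
    then have "\<forall>\<^sub>F k in sequentially. norm (x k - xb) \<le> 1 * real k powr (- ((1 - q) / (2 * q - 1)))"
      by eventually_elim simp
    then show ?thesis by (intro exI[of _ 1]) auto
  next
    case pos
    have "0 < 2 * q - 1" using that by simp
    from sublinear_decrease_bound[of \<kappa> "2 * q - 1" s, OF \<kappa>[OF pos] this pos] decrease[OF pos]
    obtain C where C: "0 < C" "\<forall>\<^sub>F k in sequentially. s k \<le> C * real k powr (- (1 / (2 * q - 1)))"
      by auto
    have "\<forall>\<^sub>F k in sequentially. norm (x k - xb) \<le>
        ((B + 1) * C powr (1 - q)) * real k powr (- ((1 - q) / (2 * q - 1)))"
      using C(2) bound
    proof eventually_elim
      case (elim k)
      have "norm (x k - xb) \<le> B * s k powr (1 - q)" by (rule elim(2))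
      also have "\<dots> \<le> (B + 1) * (C * real k powr (- (1 / (2 * q - 1)))) powr (1 - q)"
        using elim(1) B q s(2)[of k] by (intro mult_mono powr_mono2) auto
      also have "\<dots> = ((B + 1) * C powr (1 - q)) * real k powr (- ((1 - q) / (2 * q - 1)))"
        using C(1) by (simp add: powr_mult powr_powr)
      finally show ?case .
    qed
    then show ?thesis using C B by (intro exI[of _ "(B + 1) * C powr (1 - q)"]) auto
  qed
qed

section \<open>Convergence of the boosted DC algorithm\<close>

theorem theorem6:
  fixes g h \<phi> :: "real ^ 'n \<Rightarrow> ereal"
    and \<rho> \<alpha> \<beta> lbar L :: real
    and x u y :: "nat \<Rightarrow> real ^ 'n"
    and l0 l :: "nat \<Rightarrow> real"
    and xb :: "real ^ 'n"
  assumes "\<forall>v. g v \<noteq> -\<infinity>" and "\<forall>v. h v \<noteq> -\<infinity>"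
    and "\<forall>v. \<phi> v = g v - h v" and "\<forall>v. \<phi> v \<noteq> -\<infinity>"
    and "0 < \<rho>" and "strongly_convex \<rho> g" and "strongly_convex \<rho> h"
    and "continuous_on {v. \<phi> v < \<infinity>} \<phi>"
    and "0 < \<alpha>" and "0 < lbar" and "0 < \<beta>" and "\<beta> < 1"
    and "bdca g h \<alpha> \<beta> x u y l0 l"
    and "\<forall>k. strictly_differentiable g (x k) \<and> strictly_differentiable g (y k)"
    and "strictly_differentiable g xb"
    and "\<exists>r. strict_mono r \<and> (x \<circ> r) \<longlonglongrightarrow> xb"
    and "gradient_lipschitz_around g L xb"
    and "symmetric_PLK \<phi> xb"
  shows
    "(\<forall>\<^sub>F k in sequentially.
        \<phi> (x (Suc k)) \<le>
          \<phi> (x k) - ereal ((\<alpha> * (l k)\<^sup>2 + \<rho>) / (1 + l k)\<^sup>2 * (norm (x (Suc k) - x k))\<^sup>2)) \<and>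
     (\<forall>\<^sub>F k in sequentially.
        \<exists>w\<in>symmetric_subdiff \<phi> (x k). norm w \<le> L * norm (x (Suc k) - x k)) \<and>
     x \<longlonglongrightarrow> xb \<and>
     0 \<in> symmetric_subdiff \<phi> xb \<and>
     symmetric_subdiff \<phi> xb = (\<lambda>v. gradient g xb - v) ` convex_subdiff h xb \<and>
     (\<forall>M q. 0 < M \<and> 0 \<le> q \<and> q < 1 \<and> symmetric_PLK_exponent \<phi> xb M q \<longrightarrow>
        (q < 1 / 2 \<longrightarrow> (\<forall>\<^sub>F k in sequentially. x k = xb)) \<and>
        (q = 1 / 2 \<longrightarrow>
          (\<exists>C>0. \<exists>c\<in>{0<..<1}. \<forall>\<^sub>F k in sequentially. norm (x k - xb) \<le> C * c ^ k)) \<and>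
        (1 / 2 < q \<longrightarrow>
          (\<exists>\<sigma>>0. \<forall>\<^sub>F k in sequentially.
             norm (x k - xb) \<le> \<sigma> * real k powr (- ((1 - q) / (2 * q - 1))))))"
proof -
  interpret dc_function g h \<phi> \<rho>
    by standard (use assms in auto)
  have \<rho>_pos: "0 < \<rho>" and \<alpha>: "0 < \<alpha>" by fact+
  have g_fin: "\<bar>g (x k)\<bar> \<noteq> \<infinity>" "\<bar>g (y k)\<bar> \<noteq> \<infinity>" "\<bar>g xb\<bar> \<noteq> \<infinity>" for k
    by (rule finite_near_imp_finite, use assms(14,15) in \<open>simp add: strictly_differentiable_def\<close>)+
  define f where "f = (\<lambda>v. real_of_ereal (\<phi> v))"
  have f_eq: "real_of_ereal (\<phi> v) = f v" for v by (simp add: f_def)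
  have \<phi>_real: "\<phi> (x k) = ereal (f (x k))" "\<phi> (y k) = ereal (f (y k))" "\<phi> xb = ereal (f xb)" for k
    using g_fin finite_\<phi> by (simp_all add: f_def ereal_real)

  \<comment> \<open>\<open>p k\<close> replaces the given \<open>u k\<close>, which is arbitrary once the run has stopped\<close>
  have "\<forall>k. \<exists>p. p \<in> convex_subdiff h (x k) \<and> p \<in> convex_subdiff g (y k) \<and>
      f (y k) \<le> f (x k) - \<rho> * (norm (y k - x k))\<^sup>2 \<and> 0 \<le> l k \<and>
      x (Suc k) - x k = (1 + l k) *\<^sub>R (y k - x k) \<and>
      f (x (Suc k)) \<le> f (y k) - \<alpha> * (l k)\<^sup>2 * (norm (y k - x k))\<^sup>2"
  proof
    fix k
    obtain p where p: "p \<in> convex_subdiff h (x k)"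
      "is_arg_min (\<lambda>v. g v - ereal (p \<bullet> v)) (\<lambda>_. True) (y k)" "0 \<le> l k"
      "x (Suc k) = x k + (1 + l k) *\<^sub>R (y k - x k)"
      "\<phi> (x (Suc k)) \<le> \<phi> (y k) - ereal (\<alpha> * (l k)\<^sup>2 * (norm (y k - x k))\<^sup>2)"
      using bdca_step[OF assms(13) less_imp_le[OF \<open>0 < \<beta>\<close>], of k] unfolding \<phi>_eq by blast
    from sufficient_decrease[OF p(1,2) g_fin(1,2)] p
    show "\<exists>p. p \<in> convex_subdiff h (x k) \<and> p \<in> convex_subdiff g (y k) \<and>
      f (y k) \<le> f (x k) - \<rho> * (norm (y k - x k))\<^sup>2 \<and> 0 \<le> l k \<and>
      x (Suc k) - x k = (1 + l k) *\<^sub>R (y k - x k) \<and>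
      f (x (Suc k)) \<le> f (y k) - \<alpha> * (l k)\<^sup>2 * (norm (y k - x k))\<^sup>2"
      unfolding \<phi>_real by (intro exI[of _ p]) simp
  qed
  then obtain p where p: "\<And>k. p k \<in> convex_subdiff h (x k)" "\<And>k. p k \<in> convex_subdiff g (y k)"
    and f_y: "\<And>k. f (y k) \<le> f (x k) - \<rho> * (norm (y k - x k))\<^sup>2" and l: "\<And>k. 0 \<le> l k"
    and move: "\<And>k. x (Suc k) - x k = (1 + l k) *\<^sub>R (y k - x k)"
    and f_x: "\<And>k. f (x (Suc k)) \<le> f (y k) - \<alpha> * (l k)\<^sup>2 * (norm (y k - x k))\<^sup>2"
    by metis
  have norm_move: "norm (x (Suc k) - x k) = (1 + l k) * norm (y k - x k)" for k
    using l[of k] by (simp add: move)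
  have y_near: "norm (y k - x k) \<le> norm (x (Suc k) - x k)" for k
    using l[of k] mult_right_mono[of 1 "1 + l k" "norm (y k - x k)"] by (simp add: norm_move)

  have descent: "f (x (Suc k)) \<le>
      f (x k) - (\<alpha> * (l k)\<^sup>2 + \<rho>) / (1 + l k)\<^sup>2 * (norm (x (Suc k) - x k))\<^sup>2" for k
  proof -
    have "(\<alpha> * (l k)\<^sup>2 + \<rho>) / (1 + l k)\<^sup>2 * (norm (x (Suc k) - x k))\<^sup>2
        = (\<alpha> * (l k)\<^sup>2 + \<rho>) * (norm (y k - x k))\<^sup>2"
      using l[of k] by (simp add: norm_move power_mult_distrib)
    then show ?thesis using f_x[of k] f_y[of k] by (simp add: algebra_simps)
  qed
  define c where "c = \<alpha> * \<rho> / (\<alpha> + \<rho>)"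
  have c: "0 < c" using \<rho>_pos \<alpha> by (simp add: c_def)
  have c_le: "c \<le> (\<alpha> * t\<^sup>2 + \<rho>) / (1 + t)\<^sup>2" if "0 \<le> t" for t
  proof -
    \<comment> \<open>the coefficient attains its minimum at \<open>t = \<rho> / \<alpha>\<close>\<close>
    have "0 \<le> (\<alpha> * t - \<rho>)\<^sup>2" by simp
    then have "\<alpha> * \<rho> * (1 + t)\<^sup>2 \<le> (\<alpha> * t\<^sup>2 + \<rho>) * (\<alpha> + \<rho>)"
      by (simp add: power2_eq_square algebra_simps)
    then show ?thesis using that \<rho>_pos \<alpha> by (simp add: c_def divide_simps)
  qed
  define s where "s = (\<lambda>k. f (x k) - f xb)"
  have s_desc: "c * (norm (x (Suc k) - x k))\<^sup>2 \<le> s k - s (Suc k)" for k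
    using descent[of k] mult_right_mono[OF c_le[OF l[of k]], of "(norm (x (Suc k) - x k))\<^sup>2"]
    by (simp add: s_def)

  obtain \<eta> \<psi> where PLK: "symmetric_PLK_with \<phi> xb \<eta> \<psi>"
    using assms(18) unfolding symmetric_PLK_def by blast
  obtain V where V: "open V" "xb \<in> V" "continuous_on V \<phi>"
    using PLK unfolding symmetric_PLK_with_def by blast
  have cont: "isCont \<phi> xb" using V continuous_on_eq_continuous_at by blast
  obtain \<sigma> where \<sigma>: "strict_mono \<sigma>" "(x \<circ> \<sigma>) \<longlonglongrightarrow> xb" using assms(16) by blast
  have "(\<lambda>k. \<phi> (x (\<sigma> k))) \<longlonglongrightarrow> \<phi> xb"
    using isCont_tendsto_compose[OF cont \<sigma>(2)] by (simp add: comp_def)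
  then have sub_lim: "(\<lambda>k. s (\<sigma> k)) \<longlonglongrightarrow> 0"
    unfolding \<phi>_real s_def by (simp add: LIM_zero)
  have s_Suc: "s (Suc k) \<le> s k" for k
    using s_desc[of k] c by (smt (verit) mult_nonneg_nonneg zero_le_power2)
  have s_mono: "s m \<le> s k" if "k \<le> m" for k m
    using lift_Suc_antimono_le[of s, OF s_Suc that] .
  have s_nonneg: "0 \<le> s k" for k
  proof (rule tendsto_upperbound[OF sub_lim])
    show "\<forall>\<^sub>F j in sequentially. s (\<sigma> j) \<le> s k"
      using eventually_ge_at_top[of k]
      by eventually_elim (use \<sigma>(1) s_mono seq_suble order_trans in blast)
  qed simp
  have s_lim: "s \<longlonglongrightarrow> 0"
  proof (rule LIMSEQ_I)
    fix \<epsilon> :: real assume "0 < \<epsilon>"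
    then obtain j where "s (\<sigma> j) < \<epsilon>"
      using order_tendstoD(2)[OF sub_lim] by (auto simp: eventually_sequentially)
    then have "norm (s k - 0) < \<epsilon>" if "\<sigma> j \<le> k" for k
      using s_mono[OF that] s_nonneg[of k] by simp
    then show "\<exists>k0. \<forall>k\<ge>k0. norm (s k - 0) < \<epsilon>" by blast
  qed
  have move_lim: "(\<lambda>k. norm (x (Suc k) - x k)) \<longlonglongrightarrow> 0"
  proof -
    have "(\<lambda>k. (norm (x (Suc k) - x k))\<^sup>2) \<longlonglongrightarrow> 0"
    proof (rule tendsto_sandwich[OF _ _ tendsto_const])
      show "(\<lambda>k. s k / c) \<longlonglongrightarrow> 0" using tendsto_divide[OF s_lim tendsto_const[of c]] c by simp
      show "\<forall>\<^sub>F k in sequentially. (norm (x (Suc k) - x k))\<^sup>2 \<le> s k / c"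
      proof (intro always_eventually allI)
        fix k show "(norm (x (Suc k) - x k))\<^sup>2 \<le> s k / c"
          using s_desc[of k] s_nonneg[of "Suc k"] c by (simp add: field_simps)
      qed
    qed simp
    then show ?thesis by simp
  qed

  obtain U where U: "open U" "xb \<in> U" "\<And>v. v \<in> U \<Longrightarrow> \<exists>a. has_gradient g v a"
    and Lip: "L-lipschitz_on U (gradient g)"
    using assms(17) unfolding gradient_lipschitz_around_def by blast
  have L: "0 \<le> L" using Lip lipschitz_on_nonneg by blast
  have grad: "has_gradient g v (gradient g v)" if "v \<in> U" for v
    using U(3)[OF that] gradient_eqI by metis
  obtain r0 where r0: "0 < r0" "ball xb r0 \<subseteq> U" using U(1,2) open_contains_ball by blast
  have p_grad: "p k = gradient g (y k)" if "y k \<in> U" for k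
    using convex_subgradient_eq_gradient[OF grad[OF that] p(2)] .

  \<comment> \<open>half the radius for \<open>x k\<close>, so that \<open>y k\<close>, too, lies where the gradient is Lipschitz\<close>
  have small: "\<forall>\<^sub>F k in sequentially. norm (x (Suc k) - x k) < r0 / 2"
    using order_tendstoD(2)[OF move_lim, of "r0 / 2"] r0(1) by simp
  have subgrad: "\<forall>\<^sub>F k in sequentially. x k \<in> ball xb (r0 / 2) \<longrightarrow>
      gradient g (x k) - p k \<in> symmetric_subdiff \<phi> (x k) \<and>
      norm (gradient g (x k) - p k) \<le> L * norm (x (Suc k) - x k)"
    using small
  proof (rule eventually_mono, intro impI)
    fix k
    assume elim: "norm (x (Suc k) - x k) < r0 / 2" and "x k \<in> ball xb (r0 / 2)"
    then have xk: "dist xb (x k) < r0 / 2" by simp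
    have xU: "x k \<in> U" using xk r0 by (intro subsetD[OF r0(2)]) simp
    have "dist (x k) (y k) < r0 / 2"
      using elim y_near[of k] by (simp add: dist_norm norm_minus_commute[of "x k" "y k"])
    then have "dist xb (y k) < r0" using xk dist_triangle[of xb "y k" "x k"] by simp
    then have yU: "y k \<in> U" by (intro subsetD[OF r0(2)]) simp
    have "norm (gradient g (x k) - p k) \<le> L * norm (y k - x k)"
      using lipschitz_onD[OF Lip xU yU] by (simp add: p_grad[OF yU] dist_norm norm_minus_commute[of "x k" "y k"])
    also have "\<dots> \<le> L * norm (x (Suc k) - x k)"
      using y_near[of k] L by (rule mult_left_mono)
    finally show "gradient g (x k) - p k \<in> symmetric_subdiff \<phi> (x k) \<and>
      norm (gradient g (x k) - p k) \<le> L * norm (x (Suc k) - x k)"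
      using gradient_minus_subgradient_symmetric[OF grad[OF xU] p(1)] by blast
  qed

  \<comment> \<open>stated for any \<open>\<psi>\<close>: one such function gives convergence, the power function the rates\<close>
  have KL: "\<exists>r>0. \<forall>\<^sub>F k in sequentially. x k \<in> ball xb r \<longrightarrow> 0 < s k \<longrightarrow>
      1 \<le> deriv \<psi> (s k) * (L * norm (x (Suc k) - x k))"
    and KL_lim: "x \<longlonglongrightarrow> xb"
    and KL_bound: "\<forall>\<^sub>F k in sequentially. norm (x k - xb) \<le> L / c * \<psi> (s k)"
    if PLK: "symmetric_PLK_with \<phi> xb \<eta> \<psi>" for \<eta> \<psi>
  proof -
    obtain r where r: "0 < r" "\<forall>z\<in>ball xb r. \<forall>w\<in>symmetric_subdiff \<phi> z. \<bar>\<phi> z\<bar> \<noteq> \<infinity> \<longrightarrow>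
        0 < f z - f xb \<longrightarrow> f z - f xb < \<eta> \<longrightarrow> 1 \<le> deriv \<psi> (f z - f xb) * norm w"
      using symmetric_PLK_with_norm_bound[OF PLK] unfolding f_eq by (elim exE conjE)
    have \<eta>: "0 < \<eta>" and \<psi>: "concave_on {0..\<eta>} \<psi>" "\<psi> C1_differentiable_on {0<..<\<eta>}"
      "continuous_on {0..\<eta>} \<psi>" "\<psi> ` {0..\<eta>} \<subseteq> {0..}" "\<psi> 0 = 0"
      and \<psi>': "\<And>t. 0 < t \<Longrightarrow> t < \<eta> \<Longrightarrow> 0 < deriv \<psi> t"
      using PLK unfolding symmetric_PLK_with_def by auto
    define r' where "r' = min r (r0 / 2)"
    have r': "0 < r'" using r(1) r0(1) by (simp add: r'_def)
    have KL: "\<forall>\<^sub>F k in sequentially. x k \<in> ball xb r' \<longrightarrow> 0 < s k \<longrightarrow>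
      1 \<le> deriv \<psi> (s k) * (L * norm (x (Suc k) - x k))"
      using subgrad order_tendstoD(2)[OF s_lim \<eta>]
    proof (eventually_elim)
      case (elim k)
      have "1 \<le> deriv \<psi> (s k) * (L * norm (x (Suc k) - x k))" if "x k \<in> ball xb r'" "0 < s k"
      proof -
        have w: "gradient g (x k) - p k \<in> symmetric_subdiff \<phi> (x k)"
          "norm (gradient g (x k) - p k) \<le> L * norm (x (Suc k) - x k)"
          using elim that by (auto simp: r'_def)
        have "1 \<le> deriv \<psi> (s k) * norm (gradient g (x k) - p k)"
          using r(2)[rule_format, OF _ w(1)] that elim \<phi>_real(1)[of k] by (simp add: r'_def s_def)
        also have "\<dots> \<le> deriv \<psi> (s k) * (L * norm (x (Suc k) - x k))"
          using w(2) \<psi>'[of "s k"] that elim by (intro mult_left_mono) auto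
        finally show ?thesis .
      qed
      then show ?case by blast
    qed
    then show "\<exists>r>0. \<forall>\<^sub>F k in sequentially. x k \<in> ball xb r \<longrightarrow> 0 < s k \<longrightarrow>
      1 \<le> deriv \<psi> (s k) * (L * norm (x (Suc k) - x k))" using r' by blast
    show "x \<longlonglongrightarrow> xb" and "\<forall>\<^sub>F k in sequentially. norm (x k - xb) \<le> L / c * \<psi> (s k)"
      using KL_descent_convergence[OF c L r' \<eta> s_desc s_lim s_nonneg \<psi> KL \<sigma>] by blast+
  qed
  have x_lim: "x \<longlonglongrightarrow> xb" by (rule KL_lim[OF PLK])
  have in_ball: "\<forall>\<^sub>F k in sequentially. x k \<in> ball xb r" if "0 < r" for r
    using topological_tendstoD[OF x_lim, of "ball xb r"] that by simp

  have symm: "symmetric_subdiff \<phi> xb = (\<lambda>v. gradient g xb - v) ` convex_subdiff h xb"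
    using symmetric_subdiff_difference[OF U(1-3) _ cont] lipschitz_on_continuous_on[OF Lip] by blast
  have "gradient g xb \<in> convex_subdiff h xb"
  proof (rule convex_subdiff_closed[where f = h, OF x_lim])
    show "(\<lambda>k. h (x k)) \<longlonglongrightarrow> h xb"
      using isCont_h[OF grad[OF U(2)] cont] x_lim by (rule isCont_tendsto_compose)
    show "\<bar>h xb\<bar> \<noteq> \<infinity>" by (rule finite_h[OF g_fin(3)])
    have "(\<lambda>k. y k - x k) \<longlonglongrightarrow> 0"
      by (rule tendsto_norm_zero_cancel, rule tendsto_sandwich[OF _ _ tendsto_const move_lim])
        (use y_near in auto)
    from tendsto_add[OF this x_lim] have y_lim: "y \<longlonglongrightarrow> xb" by simp
    have "isCont (gradient g) xb"
      using lipschitz_on_continuous_on[OF Lip] U continuous_on_eq_continuous_at by blast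
    from isCont_tendsto_compose[OF this y_lim] show "p \<longlonglongrightarrow> gradient g xb"
    proof (rule Lim_transform_eventually)
      show "\<forall>\<^sub>F k in sequentially. gradient g (y k) = p k"
        using topological_tendstoD[OF y_lim U(1,2)] by eventually_elim (simp add: p_grad)
    qed
  qed (use p(1) in simp)
  then have stationary: "0 \<in> symmetric_subdiff \<phi> xb" unfolding symm by force

  have rates: "(q < 1 / 2 \<longrightarrow> (\<forall>\<^sub>F k in sequentially. x k = xb)) \<and>
      (q = 1 / 2 \<longrightarrow>
        (\<exists>C>0. \<exists>c\<in>{0<..<1}. \<forall>\<^sub>F k in sequentially. norm (x k - xb) \<le> C * c ^ k)) \<and>
      (1 / 2 < q \<longrightarrow>
        (\<exists>\<sigma>>0. \<forall>\<^sub>F k in sequentially.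
           norm (x k - xb) \<le> \<sigma> * real k powr (- ((1 - q) / (2 * q - 1)))))"
    if M: "0 < M" and q: "0 \<le> q" "q < 1" and E: "symmetric_PLK_exponent \<phi> xb M q" for M q
  proof -
    obtain \<eta> where PLK: "symmetric_PLK_with \<phi> xb \<eta> (\<lambda>t. M * t powr (1 - q))"
      using E unfolding symmetric_PLK_exponent_def by blast
    have deriv: "deriv (\<lambda>t. M * t powr (1 - q)) t = M * (1 - q) * t powr (- q)" if "0 < t" for t
      using that by (intro DERIV_imp_deriv) (auto intro!: derivative_eq_intros)
    obtain r where r: "0 < r" "\<forall>\<^sub>F k in sequentially. x k \<in> ball xb r \<longrightarrow> 0 < s k \<longrightarrow>
        1 \<le> deriv (\<lambda>t. M * t powr (1 - q)) (s k) * (L * norm (x (Suc k) - x k))"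
      using KL[OF PLK] by blast
    have KL_q: "\<forall>\<^sub>F k in sequentially. 0 < s k \<longrightarrow>
        s k powr q \<le> (M * (1 - q) * L) * norm (x (Suc k) - x k)"
      using r(2) in_ball[OF r(1)]
    proof eventually_elim
      case (elim k)
      show ?case
      proof
        assume s: "0 < s k"
        then have "1 \<le> s k powr (- q) * (M * (1 - q) * L * norm (x (Suc k) - x k))"
          using elim by (simp add: deriv mult_ac)
        then show "s k powr q \<le> (M * (1 - q) * L) * norm (x (Suc k) - x k)"
          using s by (simp add: powr_minus field_simps)
      qed
    qed
    have bound: "\<forall>\<^sub>F k in sequentially. norm (x k - xb) \<le> (L / c * M) * s k powr (1 - q)"
      using KL_bound[OF PLK] by (simp add: mult.assoc)
    have A: "0 \<le> M * (1 - q) * L" and B: "0 \<le> L / c * M" using M q L c by auto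
    show ?thesis
      by (intro conjI impI KL_exponent_rates[OF c A B q s_desc s_lim s_nonneg KL_q bound])
  qed

  have "\<forall>\<^sub>F k in sequentially. \<phi> (x (Suc k)) \<le>
      \<phi> (x k) - ereal ((\<alpha> * (l k)\<^sup>2 + \<rho>) / (1 + l k)\<^sup>2 * (norm (x (Suc k) - x k))\<^sup>2)"
    unfolding \<phi>_real using descent by simp
  moreover have "\<forall>\<^sub>F k in sequentially.
      \<exists>w\<in>symmetric_subdiff \<phi> (x k). norm w \<le> L * norm (x (Suc k) - x k)"
    using subgrad in_ball[of "r0 / 2"] r0(1) by (auto elim: eventually_elim2)
  ultimately show ?thesis
    using x_lim stationary symm rates by blast
qed

end
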